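(* The map $\delta: F\mapsto F(\mathbb{X}\times_C\mathbb{Y})$ defines a coassociative coproduct on $QSym^{(\ell)}$.
   Context: The color set $C$ (with $\ell$ elements, $\ell=\infty$ allowed) is an additive semigroup such that every $\gamma\in C$ has only finitely many decompositions $\gamma=\alpha+\beta$ with $\alpha,\beta\in C$. A $C$-colored alphabet $\mathbb{X}$ consists of commuting variables $x_j^{(c)}$, $c\in C$, with $j$ running over a totally ordered index set (by default $j\ge 1$). A vector composition is a matrix $\mathbf{I}=(\mathbf{i}_1,\ldots,\mathbf{i}_m)$ of nonnegative integers with rows indexed by $C$, finitely many nonzero entries, and no zero column. For a vector $\mathbf{i}=(i_c)_{c\in C}$ put $\mathbf{x}_j^{\mathbf{i}}=\prod_{c\in C}(x_j^{(c)})^{i_c}$, and define $$M_{\mathbf{I}}(\mathbb{X})=\sum_{j_1<\cdots<j_m}\mathbf{x}_{j_1}^{\mathbf{i}_1}\cdots\mathbf{x}_{j_m}^{\mathbf{i}_m}.$$ These (level $\ell$ monomial quasi-symmetric functions; formal series of bounded degree) form a basis of an algebra $QSym^{(\ell)}$. If $\mathbb{X}=\{x_r^{(c)}\}$ and $\mathbb{Y}=\{y_s^{(c)}\}$ are two $C$-colored alphabets (commuting with each other), their $C$-product $\mathbb{T}=\mathbb{X}\times_C\mathbb{Y}$ is the $C$-colored alphabet with variables $$t_{rs}^{(\gamma)}=\sum_{\alpha+\beta=\gamma}x_r^{(\alpha)}y_s^{(\beta)},\qquad\gamma\in C,$$ indexed by the pairs $(r,s)$ ordered lexicographically. $F(\mathbb{X}\times_C\mathbb{Y})$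 is regarded as an element of $QSym^{(\ell)}\otimes QSym^{(\ell)}$ by identifying $f(\mathbb{X})g(\mathbb{Y})$ with $f\otimes g$. *)

theory Defs
  imports Complex_Main
    "HOL-Library.Poly_Mapping"
    "HOL-Library.Function_Algebras"
    "HOL-Library.Product_Plus"
    "HOL-Library.Product_Lexorder"
begin

text \<open>
  A polynomial over \<open>'k\<close> with monomials in a commutative monoid \<open>'m\<close> is an element of the monoid
  algebra \<open>'m \<Rightarrow>\<^sub>0 'k\<close>; a formal series is an arbitrary coefficient function \<open>'m \<Rightarrow> 'k\<close>.
  Monomials in one alphabet are finitely supported exponent functions on the variables
  \<open>(j, c)\<close>; the default index set \<open>1, 2, 3, \<dots>\<close> is represented by the order-isomorphic type \<open>nat\<close>.
  Monomials in two mutually commuting alphabets are pairs of monomials.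
\<close>

type_synonym 'c mon = "(nat \<times> 'c) \<Rightarrow>\<^sub>0 nat"

definition scale :: "'k::field \<Rightarrow> ('m \<Rightarrow> 'k) \<Rightarrow> 'm \<Rightarrow> 'k"
  where "scale a f = (\<lambda>u. a * f u)"

interpretation series: vector_space scale
  by unfold_locales (auto simp: scale_def fun_eq_iff algebra_simps)


subsection \<open>Monomial quasi-symmetric functions\<close>

text \<open>The columns of a vector composition, listed from left to right.\<close>

definition vector_compositions :: "('c \<Rightarrow>\<^sub>0 nat) list set"
  where "vector_compositions = {I. 0 \<notin> set I}"

text \<open>
  An alphabet is a family \<open>A j c\<close> of elements of a commutative ring, so that a product alphabet,
  whose letters are polynomials, is an alphabet as well.
\<close>

definition vec_power :: "('j \<Rightarrow> 'c \<Rightarrow> 'a::comm_monoid_mult) \<Rightarrow> 'j \<Rightarrow> ('c \<Rightarrow>\<^sub>0 nat) \<Rightarrow> 'a"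
  where "vec_power A j i = (\<Prod>c\<in>Poly_Mapping.keys i. A j c ^ Poly_Mapping.lookup i c)"

definition M_term ::
    "('j \<Rightarrow> 'c \<Rightarrow> 'a::comm_monoid_mult) \<Rightarrow> ('c \<Rightarrow>\<^sub>0 nat) list \<Rightarrow> 'j list \<Rightarrow> 'a"
  where "M_term A I js = prod_list (map2 (vec_power A) js I)"

text \<open>
  The infinite sum over \<open>j\<^sub>1 < \<dots> < j\<^sub>m\<close> is taken coefficientwise. For the alphabets considered
  below, only finitely many index sequences contribute to any given monomial \<open>u\<close>.
\<close>

definition M ::
    "('j::linorder \<Rightarrow> 'c \<Rightarrow> ('m::comm_monoid_add \<Rightarrow>\<^sub>0 'k::field)) \<Rightarrow> ('c \<Rightarrow>\<^sub>0 nat) list \<Rightarrow> ('m \<Rightarrow> 'k)"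
  where "M A I = (\<lambda>u. \<Sum>js | length js = length I \<and> sorted_wrt (<) js \<and>
                             Poly_Mapping.lookup (M_term A I js) u \<noteq> 0.
                        Poly_Mapping.lookup (M_term A I js) u)"

definition X_alph :: "nat \<Rightarrow> 'c \<Rightarrow> ('c mon \<Rightarrow>\<^sub>0 'k::field)"
  where "X_alph j c = Poly_Mapping.single (Poly_Mapping.single (j, c) 1) 1"

definition QSym :: "('c mon \<Rightarrow> 'k::field) set"
  where "QSym = series.span (M X_alph ` vector_compositions)"

text \<open>
  The value \<open>F(A)\<close> of a quasi-symmetric function on an alphabet \<open>A\<close> over any totally ordered index
  set: expand \<open>F\<close> in the monomial basis and replace each \<open>M\<^sub>I(X)\<close> by \<open>M\<^sub>I(A)\<close>.
\<close>

definition is_value ::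
    "('j::linorder \<Rightarrow> 'c \<Rightarrow> ('m::comm_monoid_add \<Rightarrow>\<^sub>0 'k::field)) \<Rightarrow> ('c mon \<Rightarrow> 'k) \<Rightarrow> ('m \<Rightarrow> 'k) \<Rightarrow> bool"
  where "is_value A F G \<longleftrightarrow>
    (\<exists>a :: ('c \<Rightarrow>\<^sub>0 nat) list \<Rightarrow>\<^sub>0 'k. Poly_Mapping.keys a \<subseteq> vector_compositions \<and>
       F = (\<Sum>I\<in>Poly_Mapping.keys a. scale (Poly_Mapping.lookup a I) (M X_alph I)) \<and>
       G = (\<Sum>I\<in>Poly_Mapping.keys a. scale (Poly_Mapping.lookup a I) (M A I)))"


subsection \<open>The product of two alphabets\<close>

definition X2_alph :: "nat \<Rightarrow> 'c \<Rightarrow> ('c mon \<times> 'c mon \<Rightarrow>\<^sub>0 'k::field)"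
  where "X2_alph r c = Poly_Mapping.single (Poly_Mapping.single (r, c) 1, 0) 1"

definition Y2_alph :: "nat \<Rightarrow> 'c \<Rightarrow> ('c mon \<times> 'c mon \<Rightarrow>\<^sub>0 'k::field)"
  where "Y2_alph s c = Poly_Mapping.single (0, Poly_Mapping.single (s, c) 1) 1"

text \<open>
  The letters of a product are indexed by pairs, which \<^theory>\<open>HOL-Library.Product_Lexorder\<close> orders
  lexicographically. The sum is over a finite set under the standing assumption on colors.
\<close>

definition C_product ::
    "('r \<Rightarrow> 'c::semigroup_add \<Rightarrow> 'a::comm_semiring_1) \<Rightarrow> ('s \<Rightarrow> 'c \<Rightarrow> 'a) \<Rightarrow> 'r \<times> 's \<Rightarrow> 'c \<Rightarrow> 'a"
  where "C_product A B = (\<lambda>(r, s) \<gamma>. \<Sum>(\<alpha>, \<beta>) | \<alpha> + \<beta> = \<gamma>. A r \<alpha> * B s \<beta>)"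

definition XY_alph :: "nat \<times> nat \<Rightarrow> 'c::semigroup_add \<Rightarrow> ('c mon \<times> 'c mon \<Rightarrow>\<^sub>0 'k::field)"
  where "XY_alph = C_product X2_alph Y2_alph"

definition \<delta> :: "('c::semigroup_add mon \<Rightarrow> 'k::field) \<Rightarrow> ('c mon \<times> 'c mon \<Rightarrow> 'k)"
  where "\<delta> F = (THE G. is_value XY_alph F G)"


subsection \<open>Tensor products and coproducts\<close>

text \<open>
  For spaces of series \<open>V\<close> and \<open>W\<close>, the tensor \<open>f \<otimes> g\<close> is identified with the series \<open>f(X) g(Y)\<close>,
  whose coefficient at the monomial \<open>(u, v)\<close> is \<open>f u * g v\<close>, and \<open>V \<otimes> W\<close> with the span of these
  products. The identification is faithful by the lemma \<open>tens_faithful\<close> below, since every element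
  of the abstract tensor product is a finite sum of \<open>f\<^sub>i \<otimes> g\<^sub>i\<close> with linearly independent \<open>g\<^sub>i\<close>.
\<close>

definition tens :: "('m \<Rightarrow> 'k::field) \<Rightarrow> ('n \<Rightarrow> 'k) \<Rightarrow> ('m \<times> 'n \<Rightarrow> 'k)"
  where "tens f g = (\<lambda>(u, v). f u * g v)"

definition tensor_space ::
    "('m \<Rightarrow> 'k::field) set \<Rightarrow> ('n \<Rightarrow> 'k) set \<Rightarrow> ('m \<times> 'n \<Rightarrow> 'k) set"
  where "tensor_space V W = series.span {tens f g |f g. f \<in> V \<and> g \<in> W}"

lemma tens_faithful:
  fixes f :: "('n \<Rightarrow> 'k::field) \<Rightarrow> ('m \<Rightarrow> 'k)"
  assumes "finite S" "series.independent S" "(\<Sum>g\<in>S. tens (f g) g) = 0" "g \<in> S"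
  shows "f g = 0"
proof
  fix u
  have ev: "(\<Sum>g\<in>T. h g) v = (\<Sum>g\<in>T. h g v)" if "finite T"
    for h :: "('n \<Rightarrow> 'k) \<Rightarrow> 'z \<Rightarrow> 'k" and T v
    using that by (induction T rule: finite_induct) auto
  have "(\<Sum>g\<in>S. scale (f g u) g) = 0"
  proof
    fix v
    have "(\<Sum>g\<in>S. scale (f g u) g) v = (\<Sum>g\<in>S. tens (f g) g) (u, v)"
      by (simp add: ev assms(1) scale_def tens_def)
    then show "(\<Sum>g\<in>S. scale (f g u) g) v = 0 v"
      using assms(3) by simp
  qed
  then show "f g u = 0 u"
    using series.independentD[OF assms(2,1), of "\<lambda>g. f g u" g] assms(4) by simp
qed

definition linear_on :: "('m \<Rightarrow> 'k::field) set \<Rightarrow> (('m \<Rightarrow> 'k) \<Rightarrow> ('n \<Rightarrow> 'k)) \<Rightarrow> bool"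
  where "linear_on V \<phi> \<longleftrightarrow>
    (\<forall>f\<in>V. \<forall>g\<in>V. \<phi> (f + g) = \<phi> f + \<phi> g) \<and> (\<forall>a. \<forall>f\<in>V. \<phi> (scale a f) = scale a (\<phi> f))"

text \<open>\<open>\<Phi>\<close> is the map \<open>\<phi> \<otimes> \<psi>\<close> on \<open>V \<otimes> W\<close>; these conditions determine it uniquely there.\<close>

definition is_tensor_map ::
    "('m \<Rightarrow> 'k::field) set \<Rightarrow> ('n \<Rightarrow> 'k) set \<Rightarrow>
     (('m \<Rightarrow> 'k) \<Rightarrow> ('p \<Rightarrow> 'k)) \<Rightarrow> (('n \<Rightarrow> 'k) \<Rightarrow> ('q \<Rightarrow> 'k)) \<Rightarrow>
     (('m \<times> 'n \<Rightarrow> 'k) \<Rightarrow> ('p \<times> 'q \<Rightarrow> 'k)) \<Rightarrow> bool"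
  where "is_tensor_map V W \<phi> \<psi> \<Phi> \<longleftrightarrow>
    linear_on (tensor_space V W) \<Phi> \<and> (\<forall>f\<in>V. \<forall>g\<in>W. \<Phi> (tens f g) = tens (\<phi> f) (\<psi> g))"

text \<open>The canonical isomorphism \<open>(U \<otimes> V) \<otimes> W \<rightarrow> U \<otimes> (V \<otimes> W)\<close>.\<close>

definition tens_assoc :: "(('m \<times> 'n) \<times> 'p \<Rightarrow> 'k) \<Rightarrow> ('m \<times> 'n \<times> 'p \<Rightarrow> 'k)"
  where "tens_assoc G = (\<lambda>(u, v, w). G ((u, v), w))"

definition coassociative_coproduct ::
    "('m \<Rightarrow> 'k::field) set \<Rightarrow> (('m \<Rightarrow> 'k) \<Rightarrow> ('m \<times> 'm \<Rightarrow> 'k)) \<Rightarrow> bool"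
  where "coassociative_coproduct V \<Delta> \<longleftrightarrow>
    linear_on V \<Delta> \<and> \<Delta> ` V \<subseteq> tensor_space V V \<and>
    (\<exists>\<Delta>_id id_\<Delta>. is_tensor_map V V \<Delta> id \<Delta>_id \<and> is_tensor_map V V id \<Delta> id_\<Delta> \<and>
       (\<forall>F\<in>V. tens_assoc (\<Delta>_id (\<Delta> F)) = id_\<Delta> (\<Delta> F)))"

end

theory Submission
  imports Defs
begin

text \<open>
  A series is quasi-symmetric exactly when its coefficient at a monomial depends only on the list of
  nonzero columns of the monomial, with finitely many lists contributing. Hence \<open>M\<^sub>I(X)\<close> is the
  indicator function of the monomials with columns \<open>I\<close>, and for any alphabet \<open>A\<close> the series \<open>M\<^sub>I(A)\<close> is
  the sum of the values at \<open>A\<close> of all monomials with columns \<open>I\<close>. Strictly increasing relabellings of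
  the two index sets are ring homomorphisms permuting the letters of a product alphabet, so the
  coefficient of \<open>M\<^sub>I(X \<times> Y)\<close> at \<open>(\<mu>, \<nu>)\<close> depends only on the columns of \<open>\<mu>\<close> and \<open>\<nu>\<close>, for all totally
  ordered index sets; finiteness of decompositions bounds the columns that occur. Substituting
  \<open>X \<times> Y\<close> for the first alphabet is again a ring homomorphism on finitely many letters, so that
  \<open>(\<delta> \<otimes> id) \<delta> M\<^sub>I\<close> is \<open>M\<^sub>I((X \<times> Y) \<times> Z)\<close>, and symmetrically on the other side. Both product alphabets
  agree by associativity of the colors and of the lexicographic order.
\<close>

abbreviation "lookup \<equiv> Poly_Mapping.lookup"
abbreviation "keys \<equiv> Poly_Mapping.keys"
abbreviation "single \<equiv> Poly_Mapping.single"

subsection \<open>Monomials\<close>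

text \<open>Removing one letter at a time suits every map that turns sums of exponents into sums or
  products: only the unit and a single letter remain to be checked.\<close>

lemma monomial_induct [case_names zero add]:
  fixes u :: "'x \<Rightarrow>\<^sub>0 nat"
  assumes zero: "P 0" and add: "\<And>u x. P u \<Longrightarrow> P (u + single x 1)"
  shows "P u"
proof (induction u rule: Poly_Mapping.update_induct)
  case const
  show ?case by (fact zero)
next
  case (update u x n)
  have "P (u + single x m)" for m
  proof (induction m)
    case (Suc m)
    have "u + single x (Suc m) = (u + single x m) + single x 1"
      by (simp add: add.assoc flip: single_add)
    then show ?case using add[OF Suc] by simp
  qed (simp add: update)
  moreover have "Poly_Mapping.update x n u = u + single x n"
    using update(1) by (intro poly_mapping_eqI)
      (auto simp: lookup_update lookup_add lookup_single in_keys_iff when_def)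
  ultimately show ?case by simp
qed

section \<open>Degree, and finiteness of bounded sets of monomials\<close>

lemma keys_add_nat: "keys (u + v) = keys u \<union> keys v" for u v :: "'x \<Rightarrow>\<^sub>0 nat"
  by (auto simp: in_keys_iff lookup_add)

definition deg :: "('x \<Rightarrow>\<^sub>0 nat) \<Rightarrow> nat"
  where "deg u = (\<Sum>x\<in>keys u. lookup u x)"

lemma deg_0 [simp]: "deg 0 = 0"
  by (simp add: deg_def)

lemma deg_single [simp]: "deg (single x n) = n"
  by (simp add: deg_def)

lemma deg_add: "deg (u + v) = deg u + deg v"
  unfolding deg_def by (rule setsum_keys_plus_distrib) auto

lemma lookup_le_deg: "lookup u x \<le> deg u"
  by (cases "x \<in> keys u") (auto simp: deg_def in_keys_iff intro: member_le_sum)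

lemma card_keys_le_deg: "card (keys u) \<le> deg u"
proof -
  have "card (keys u) = (\<Sum>x\<in>keys u. 1)" by simp
  also have "\<dots> \<le> deg u"
    unfolding deg_def by (rule sum_mono) (simp add: in_keys_iff Suc_le_eq)
  finally show ?thesis .
qed

text \<open>The exponents form a function from the finite set \<open>D\<close> to
  \<open>{..n}\<close>, extended by 0, and there are finitely many of these.\<close>

lemma finite_bounded_monomials:
  assumes "finite D"
  shows "finite {u :: 'x \<Rightarrow>\<^sub>0 nat. keys u \<subseteq> D \<and> (\<forall>x. lookup u x \<le> n)}"
proof (rule finite_imageD)
  let ?S = "{u :: 'x \<Rightarrow>\<^sub>0 nat. keys u \<subseteq> D \<and> (\<forall>x. lookup u x \<le> n)}"
  let ?F = "{f. \<forall>x. (x \<in> D \<longrightarrow> f x \<in> {..n}) \<and> (x \<notin> D \<longrightarrow> f x = 0)}"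
  have "lookup u \<in> ?F" if "u \<in> ?S" for u
    using that not_in_keys_iff_lookup_eq_zero[of _ u] by blast
  then have "lookup ` ?S \<subseteq> ?F" by (rule image_subsetI)
  moreover have "finite ?F"
    by (rule finite_set_of_finite_funs) (simp_all add: assms)
  ultimately show "finite (lookup ` ?S)"
    by (rule finite_subset)
  show "inj_on lookup ?S"
    by (rule inj_onI) (simp add: Poly_Mapping.lookup_inject)
qed

section \<open>Rows and columns of a monomial\<close>

definition rows :: "('j \<times> 'c \<Rightarrow>\<^sub>0 nat) \<Rightarrow> 'j set"
  where "rows u = fst ` keys u"

lemma finite_rows [simp]: "finite (rows u)"
  by (simp add: rows_def)

lemma rows_0 [simp]: "rows 0 = {}"
  by (simp add: rows_def)

lemma rows_add: "rows (u + v) = rows u \<union> rows v"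
  by (simp add: rows_def keys_add_nat image_Un)

text \<open>Monomials are written additively, so this sum is the vector power of the letters with
  index \<open>j\<close>; see \<open>ev_row\<close>.\<close>

definition row :: "'j \<Rightarrow> ('c \<Rightarrow>\<^sub>0 nat) \<Rightarrow> ('j \<times> 'c \<Rightarrow>\<^sub>0 nat)"
  where "row j i = (\<Sum>c\<in>keys i. single (j, c) (lookup i c))"

lemma lookup_row: "lookup (row j i) (j', c) = (if j' = j then lookup i c else 0)"
proof -
  have "lookup (row j i) (j', c) = (\<Sum>c'\<in>keys i. if c' = c then (if j' = j then lookup i c else 0) else 0)"
    unfolding row_def lookup_sum by (rule sum.cong) (auto simp: lookup_single when_def)
  then show ?thesis by (simp add: in_keys_iff)
qed

lemma keys_row: "keys (row j i) = Pair j ` keys i"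
  by (auto simp: in_keys_iff lookup_row split: if_splits)

lemma rows_row: "i \<noteq> 0 \<Longrightarrow> rows (row j i) = {j}"
  by (simp add: rows_def keys_row image_image image_constant_conv)

lemma deg_row: "deg (row j i) = deg i"
proof -
  have "deg (row j i) = (\<Sum>c\<in>keys i. lookup (row j i) (j, c))"
    unfolding deg_def keys_row by (subst sum.reindex) (auto simp: inj_on_def)
  then show ?thesis by (simp add: lookup_row deg_def)
qed

definition col :: "('j \<times> 'c \<Rightarrow>\<^sub>0 nat) \<Rightarrow> 'j \<Rightarrow> ('c \<Rightarrow>\<^sub>0 nat)"
  where "col u j = Poly_Mapping.map_key (Pair j) u"

lemma lookup_col: "lookup (col u j) c = lookup u (j, c)"
  by (simp add: col_def map_key.rep_eq inj_def)

lemma col_eq_0_iff: "col u j = 0 \<longleftrightarrow> j \<notin> rows u"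
proof -
  have "j \<in> rows u \<longleftrightarrow> (\<exists>c. lookup u (j, c) \<noteq> 0)"
    unfolding rows_def in_keys_iff[symmetric] by force
  then show ?thesis
    by (simp add: poly_mapping_eq_iff fun_eq_iff lookup_col)
qed

text \<open>In the notation for \<open>M\<^sub>I\<close>, \<open>place I js\<close> is the summand for the indices \<open>j\<^sub>1 < \<dots> < j\<^sub>m\<close> listed in \<open>js\<close>.\<close>

definition place :: "('c \<Rightarrow>\<^sub>0 nat) list \<Rightarrow> 'j list \<Rightarrow> ('j \<times> 'c \<Rightarrow>\<^sub>0 nat)"
  where "place I js = sum_list (map2 row js I)"

definition columns :: "('j::linorder \<times> 'c \<Rightarrow>\<^sub>0 nat) \<Rightarrow> ('c \<Rightarrow>\<^sub>0 nat) list"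
  where "columns u = map (col u) (sorted_list_of_set (rows u))"

lemma place_Nil [simp]: "place I [] = 0" "place [] js = 0"
  by (simp_all add: place_def)

lemma place_Cons [simp]: "place (i # I) (j # js) = row j i + place I js"
  by (simp add: place_def)

lemma rows_place:
  "length js = length I \<Longrightarrow> 0 \<notin> set I \<Longrightarrow> rows (place I js) = set js"
  by (induction js I rule: list_induct2) (auto simp: rows_add rows_row)

lemma deg_place: "length js = length I \<Longrightarrow> deg (place I js) = sum_list (map deg I)"
  by (induction js I rule: list_induct2) (auto simp: deg_add deg_row)

text \<open>The second claim feeds the induction for the first: as \<open>j\<close> is absent from
  the tail, the tail has zero column at \<open>j\<close>, so the column there is exactly
  \<open>i\<close>.\<close>

lemma map_col_place:
  assumes "length js = length I" "distinct js"
  shows "map (col (place I js)) js = I \<and> (\<forall>j. j \<notin> set js \<longrightarrow> col (place I js) j = 0)"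
  using assms
proof (induction js I rule: list_induct2)
  case Nil
  show ?case by (auto simp: poly_mapping_eq_iff fun_eq_iff lookup_col)
next
  case (Cons j js i I)
  have col_j: "col (place (i # I) (j # js)) j = i"
  proof (rule poly_mapping_eqI)
    fix c
    have "lookup (place I js) (j, c) = 0"
      using Cons by (metis distinct.simps(2) lookup_col lookup_zero)
    then show "lookup (col (place (i # I) (j # js)) j) c = lookup i c"
      by (simp add: lookup_col lookup_add lookup_row)
  qed
  have col_other: "col (place (i # I) (j # js)) j' = col (place I js) j'" if "j' \<noteq> j" for j'
    using that by (intro poly_mapping_eqI) (simp add: lookup_col lookup_add lookup_row)
  have "map (col (place (i # I) (j # js))) js = map (col (place I js)) js"
    using Cons.prems by (intro map_cong col_other) auto
  then show ?case
    using Cons col_j col_other by (simp del: map_eq_conv place_Cons)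
qed

lemma monomial_eqI: "(\<And>j. col u j = col v j) \<Longrightarrow> u = v"
  by (rule poly_mapping_eqI) (metis lookup_col surj_pair)

text \<open>Both sides have the same column at every index, zero columns included. With
  \<open>columns_place\<close>, a monomial amounts to a vector composition together with an
  increasing list of indices.\<close>

lemma place_columns: "place (columns u) (sorted_list_of_set (rows u)) = u"
proof (rule monomial_eqI)
  fix j
  let ?js = "sorted_list_of_set (rows u)"
  have "map (col (place (columns u) ?js)) ?js = map (col u) ?js"
    and "j \<notin> set ?js \<Longrightarrow> col (place (columns u) ?js) j = 0"
    using map_col_place[of ?js "columns u"] by (auto simp: columns_def)
  then show "col (place (columns u) ?js) j = col u j"
    using col_eq_0_iff[of u j] by (cases "j \<in> rows u") auto
qed

lemma columns_in_vector_compositions: "columns u \<in> vector_compositions"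
  using col_eq_0_iff[of u] by (auto simp: vector_compositions_def columns_def image_iff)

lemma length_columns [simp]: "length (columns u) = card (rows u)"
  by (simp add: columns_def)

lemma columns_place:
  assumes "length js = length I" "I \<in> vector_compositions" "sorted_wrt (<) js"
  shows "columns (place I js) = I"
proof -
  have "sorted_list_of_set (set js) = js"
    using assms(3) by (simp add: sorted_list_of_set.idem_if_sorted_distinct strict_sorted_iff)
  then show ?thesis
    using assms map_col_place[of js I]
    by (simp add: columns_def rows_place vector_compositions_def strict_sorted_iff)
qed

lemma keys_columns: "(\<Union>i\<in>set (columns u). keys i) = snd ` keys u"
proof -
  have "(\<Union>i\<in>set (columns u). keys i) = (\<Union>j\<in>rows u. {c. (j, c) \<in> keys u})"
    by (simp add: columns_def in_keys_iff lookup_col set_eq_iff)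
  also have "\<dots> = snd ` keys u"
    unfolding rows_def by force
  finally show ?thesis .
qed

lemma deg_columns: "sum_list (map deg (columns u)) = deg u"
  using deg_place[of "sorted_list_of_set (rows u)" "columns u"] by (simp add: place_columns)

text \<open>Even over an infinite index set, a monomial of degree at most \<open>n\<close> has at
  most \<open>n\<close> nonzero columns, each with colors in \<open>D\<close> and exponents at most
  \<open>n\<close>.\<close>

lemma finite_columns_bounded:
  assumes "finite D"
  shows "finite (columns ` {u :: ('j::linorder \<times> 'c \<Rightarrow>\<^sub>0 nat). snd ` keys u \<subseteq> D \<and> deg u \<le> n})"
proof (rule finite_subset)
  let ?C = "{i :: 'c \<Rightarrow>\<^sub>0 nat. keys i \<subseteq> D \<and> (\<forall>c. lookup i c \<le> n)}"
  show "finite {I. set I \<subseteq> ?C \<and> length I \<le> n}"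
    by (intro finite_lists_length_le finite_bounded_monomials assms)
  show "columns ` {u :: ('j \<times> 'c \<Rightarrow>\<^sub>0 nat). snd ` keys u \<subseteq> D \<and> deg u \<le> n} \<subseteq> {I. set I \<subseteq> ?C \<and> length I \<le> n}"
  proof (clarify, intro conjI subsetI)
    fix u :: "'j \<times> 'c \<Rightarrow>\<^sub>0 nat"
    assume D: "snd ` keys u \<subseteq> D" and n: "deg u \<le> n"
    show "i \<in> ?C" if i_col: "i \<in> set (columns u)" for i
    proof -
      obtain j where i: "i = col u j"
        using i_col unfolding columns_def set_map by blast
      have "keys i \<subseteq> D"
        using D i_col keys_columns[of u] by blast
      moreover have "lookup i c \<le> n" for c
        using order_trans[OF lookup_le_deg n] by (simp add: i lookup_col)
      ultimately show ?thesis by simp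
    qed
    have "card (rows u) \<le> card (keys u)"
      unfolding rows_def by (rule card_image_le) simp
    then show "length (columns u) \<le> n"
      using n card_keys_le_deg[of u] by simp
  qed
qed

text \<open>The representative, with indices starting at 0, of all monomials with the same columns.
  It lives on the default index set, so a monomial in pair-indexed letters can be fed to a series on
  \<open>'c mon\<close>.\<close>

definition pack :: "('j::linorder \<times> 'c \<Rightarrow>\<^sub>0 nat) \<Rightarrow> 'c mon"
  where "pack u = place (columns u) [0..<card (rows u)]"

lemma columns_pack [simp]: "columns (pack u) = columns u"
  unfolding pack_def by (rule columns_place) (auto simp: columns_in_vector_compositions)

lemma pack_pack [simp]: "pack (pack u) = pack u"
  by (metis columns_pack length_columns pack_def)

lemma rows_pack: "rows (pack u) = {..<card (rows u)}"
  unfolding pack_def using columns_in_vector_compositions[of u]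
  by (subst rows_place) (auto simp: vector_compositions_def)

subsection \<open>Evaluation of monomials and quasi-symmetric functions\<close>

definition ev :: "('j \<Rightarrow> 'c \<Rightarrow> 'a::comm_monoid_mult) \<Rightarrow> ('j \<times> 'c \<Rightarrow>\<^sub>0 nat) \<Rightarrow> 'a"
  where "ev A u = (\<Prod>x\<in>keys u. A (fst x) (snd x) ^ lookup u x)"

lemma ev_superset:
  assumes "finite S" "keys u \<subseteq> S"
  shows "ev A u = (\<Prod>x\<in>S. A (fst x) (snd x) ^ lookup u x)"
  unfolding ev_def using assms by (intro prod.mono_neutral_left) (auto simp: in_keys_iff)

lemma ev_0 [simp]: "ev A 0 = 1"
  by (simp add: ev_def)

lemma ev_add: "ev A (u + v) = ev A u * ev A v"
proof -
  let ?S = "keys u \<union> keys v"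
  have "ev A (u + v) = (\<Prod>x\<in>?S. A (fst x) (snd x) ^ lookup (u + v) x)"
    by (rule ev_superset) (auto simp: keys_add_nat)
  also have "\<dots> = ev A u * ev A v"
    by (simp add: ev_superset[of ?S] lookup_add power_add prod.distrib)
  finally show ?thesis .
qed

lemma ev_single [simp]: "ev A (single (j, c) (Suc 0)) = A j c"
  by (simp add: ev_def)

lemma ev_row: "ev A (row j i) = vec_power A j i"
proof -
  have "ev A (row j i) = (\<Prod>c\<in>keys i. A j c ^ lookup (row j i) (j, c))"
    unfolding ev_def keys_row by (subst prod.reindex) (auto simp: inj_on_def)
  then show ?thesis by (simp add: lookup_row vec_power_def)
qed

lemma M_term_eq_ev: "length js = length I \<Longrightarrow> M_term A I js = ev A (place I js)"
  by (induction js I rule: list_induct2) (auto simp: M_term_def ev_add ev_row)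

lemma bij_betw_place:
  fixes I :: "('c \<Rightarrow>\<^sub>0 nat) list"
  assumes "I \<in> vector_compositions"
  shows "bij_betw (place I :: 'j::linorder list \<Rightarrow> _) {js. length js = length I \<and> sorted_wrt (<) js} {u. columns u = I}"
proof (rule bij_betw_byWitness[where f' = "\<lambda>u. sorted_list_of_set (rows u)"], safe)
  fix js :: "'j list"
  assume js: "length js = length I" "sorted_wrt (<) js"
  then show "sorted_list_of_set (rows (place I js)) = js"
    using assms
    by (simp add: rows_place vector_compositions_def strict_sorted_iff
        sorted_list_of_set.idem_if_sorted_distinct)
  show "columns (place I js) = I"
    using js assms by (simp add: columns_place)
next
  fix u :: "'j \<times> 'c \<Rightarrow>\<^sub>0 nat"
  show "place (columns u) (sorted_list_of_set (rows u)) = u"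
    by (rule place_columns)
  show "length (sorted_list_of_set (rows u)) = length (columns u)"
    by simp
  show "sorted_wrt (<) (sorted_list_of_set (rows u))"
    by simp
qed

text \<open>Reindexing along \<open>place I\<close> trades increasing index lists for
  monomials.\<close>

lemma M_eq_sum_monomials:
  assumes "I \<in> vector_compositions"
  shows "M A I v = (\<Sum>u | columns u = I \<and> lookup (ev A u) v \<noteq> 0. lookup (ev A u) v)"
proof -
  let ?L = "{js. length js = length I \<and> sorted_wrt (<) js \<and> lookup (M_term A I js) v \<noteq> 0}"
  have bij: "bij_betw (place I) {js. length js = length I \<and> sorted_wrt (<) js} {u. columns u = I}"
    by (rule bij_betw_place[OF assms])
  have inj: "inj_on (place I) ?L"
    using bij_betw_imp_inj_on[OF bij] by (rule inj_on_subset) auto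
  have "place I ` ?L = {u \<in> place I ` {js. length js = length I \<and> sorted_wrt (<) js}.
      lookup (ev A u) v \<noteq> 0}"
    by (auto simp: M_term_eq_ev)
  then have img: "place I ` ?L = {u. columns u = I \<and> lookup (ev A u) v \<noteq> 0}"
    by (simp add: bij_betw_imp_surj_on[OF bij])
  show ?thesis
    unfolding M_def img[symmetric] sum.reindex[OF inj] by (rule sum.cong) (auto simp: M_term_eq_ev)
qed

lemma ev_X_alph: "ev X_alph u = single u 1"
proof (induction u rule: monomial_induct)
  case (add u x)
  then show ?case
    by (cases x) (simp add: ev_add X_alph_def mult_single)
qed simp

text \<open>Each monomial evaluates to itself at the original letters, so only \<open>u\<close> can
  contribute to the coefficient at \<open>u\<close>.\<close>

lemma M_X_alph:
  assumes "I \<in> vector_compositions"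
  shows "M X_alph I u = (if columns u = I then 1 else (0::'k::field))"
proof -
  have "{u'. columns u' = I \<and> lookup (ev X_alph u') u \<noteq> (0::'k)} = (if columns u = I then {u} else {})"
    by (auto simp: ev_X_alph lookup_single when_def)
  then show ?thesis
    unfolding M_eq_sum_monomials[OF assms] by (simp add: ev_X_alph)
qed

subsection \<open>Linear extension of multiplicative maps\<close>

text \<open>\<open>single 0 a\<close> is the constant \<open>a\<close>, so this is the linear
  extension of \<open>h\<close> to the monoid algebra, a ring homomorphism once \<open>h\<close> is
  multiplicative.\<close>

definition lin_ext :: "('m \<Rightarrow> ('n::comm_monoid_add \<Rightarrow>\<^sub>0 'k::comm_semiring_1)) \<Rightarrow> ('m \<Rightarrow>\<^sub>0 'k) \<Rightarrow> ('n \<Rightarrow>\<^sub>0 'k)"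
  where "lin_ext h p = (\<Sum>m\<in>keys p. single 0 (lookup p m) * h m)"

definition mult_hom :: "('m::comm_monoid_add \<Rightarrow> 'a::comm_semiring_1) \<Rightarrow> bool"
  where "mult_hom h \<longleftrightarrow> h 0 = 1 \<and> (\<forall>u v. h (u + v) = h u * h v)"

lemma lookup_scalar_mult: "lookup (single 0 a * q) w = a * lookup q w"
  for q :: "'n::comm_monoid_add \<Rightarrow>\<^sub>0 'k::comm_semiring_1"
  by (simp add: Poly_Mapping.map.rep_eq when_def flip: mult_map_scale_conv_mult)

lemma lookup_lin_ext: "lookup (lin_ext h p) w = (\<Sum>m\<in>keys p. lookup p m * lookup (h m) w)"
  by (simp add: lin_ext_def lookup_sum lookup_scalar_mult)

lemma lin_ext_0 [simp]: "lin_ext h 0 = 0"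
  by (simp add: lin_ext_def)

lemma lin_ext_add: "lin_ext h (p + q) = lin_ext h p + lin_ext h q"
  unfolding lin_ext_def
  by (rule setsum_keys_plus_distrib) (simp_all add: single_add distrib_right)

lemma lin_ext_sum: "lin_ext h (sum p S) = (\<Sum>x\<in>S. lin_ext h (p x))"
  by (induction S rule: infinite_finite_induct) (simp_all add: lin_ext_add)

lemma lin_ext_single: "lin_ext h (single m a) = single 0 a * h m"
  by (simp add: lin_ext_def)

lemma sum_single_lookup: "(\<Sum>m\<in>keys p. single m (lookup p m)) = p"
proof (rule poly_mapping_eqI)
  fix m
  have "lookup (\<Sum>m\<in>keys p. single m (lookup p m)) m = (\<Sum>m'\<in>keys p. if m' = m then lookup p m else 0)"
    unfolding lookup_sum by (rule sum.cong) (auto simp: lookup_single when_def)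
  then show "lookup (\<Sum>m\<in>keys p. single m (lookup p m)) m = lookup p m"
    by (simp add: in_keys_iff)
qed

lemma lin_ext_mult:
  assumes "mult_hom h"
  shows "lin_ext h (p * q) = lin_ext h p * lin_ext h q"
proof -
  have "p * q = (\<Sum>m\<in>keys p. \<Sum>n\<in>keys q. single (m + n) (lookup p m * lookup q n))"
    unfolding mult_single[symmetric] sum_product[symmetric] sum_single_lookup ..
  then have "lin_ext h (p * q) = (\<Sum>m\<in>keys p. \<Sum>n\<in>keys q. single 0 (lookup p m * lookup q n) * (h m * h n))"
    using assms by (simp add: lin_ext_sum lin_ext_single mult_hom_def)
  also have "\<dots> = (\<Sum>m\<in>keys p. \<Sum>n\<in>keys q.
      (single 0 (lookup p m) * h m) * (single 0 (lookup q n) * h n))"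
  proof (intro sum.cong refl)
    fix m n
    have "single 0 (lookup p m * lookup q n) = single (0::'b) (lookup p m) * single 0 (lookup q n)"
      by (simp add: mult_single)
    then show "single 0 (lookup p m * lookup q n) * (h m * h n) =
        (single 0 (lookup p m) * h m) * (single 0 (lookup q n) * h n)"
      by (simp only: ac_simps)
  qed
  also have "\<dots> = lin_ext h p * lin_ext h q"
    by (simp add: lin_ext_def sum_product)
  finally show ?thesis .
qed

lemma lin_ext_ev:
  assumes "mult_hom h"
  shows "lin_ext h (ev A u) = ev (\<lambda>j c. lin_ext h (A j c)) u"
proof (induction u rule: monomial_induct)
  case zero
  show ?case
    using assms lin_ext_single[of h 0 1] by (simp add: mult_hom_def)
next
  case (add u x)
  then show ?case
    by (cases x) (simp add: ev_add lin_ext_mult[OF assms])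
qed

text \<open>A product letter is a sum of products and so passes through a ring homomorphism. If a
  color has infinitely many decompositions, both sums have the default value 0.\<close>

lemma lin_ext_C_product:
  assumes "mult_hom h"
  shows "lin_ext h (C_product A B x \<gamma>) =
    C_product (\<lambda>r c. lin_ext h (A r c)) (\<lambda>s c. lin_ext h (B s c)) x \<gamma>"
  by (cases x) (simp add: C_product_def lin_ext_sum lin_ext_mult[OF assms] case_prod_unfold)

subsection \<open>Truncation to finitely many letters\<close>

definition index_chains :: "nat \<Rightarrow> 'j::linorder set \<Rightarrow> 'j list set"
  where "index_chains n D = {js. length js = n \<and> sorted_wrt (<) js \<and> set js \<subseteq> D}"

text \<open>Homomorphisms such as \<open>lin_ext h\<close> act on polynomials and not on series, so
  the series is replaced by the sum of its terms with indices in a finite set.\<close>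

definition M_fin :: "('j::linorder \<Rightarrow> 'c \<Rightarrow> 'a::comm_semiring_1) \<Rightarrow> ('c \<Rightarrow>\<^sub>0 nat) list \<Rightarrow> 'j set \<Rightarrow> 'a"
  where "M_fin A I D = (\<Sum>js\<in>index_chains (length I) D. M_term A I js)"

lemma finite_index_chains: "finite D \<Longrightarrow> finite (index_chains n D)"
  by (rule finite_subset[OF _ finite_lists_length_le[of D n]]) (auto simp: index_chains_def)

text \<open>Terms using an index outside \<open>D\<close> have coefficient 0 at \<open>v\<close>,
  and terms inside \<open>D\<close> with coefficient 0 may be added.\<close>

lemma M_eq_M_fin:
  assumes "finite D"
    and "\<And>js. length js = length I \<Longrightarrow> lookup (M_term A I js) v \<noteq> 0 \<Longrightarrow> set js \<subseteq> D"
  shows "M A I v = lookup (M_fin A I D) v"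
  unfolding M_def M_fin_def lookup_sum
proof (rule sum.mono_neutral_left)
  show "finite (index_chains (length I) D)"
    using assms(1) by (rule finite_index_chains)
qed (use assms(2) in \<open>auto simp: index_chains_def\<close>)

lemma lin_ext_M_fin:
  assumes "mult_hom h"
  shows "lin_ext h (M_fin A I D) = M_fin (\<lambda>j c. lin_ext h (A j c)) I D"
  unfolding M_fin_def lin_ext_sum
  by (rule sum.cong) (auto simp: index_chains_def M_term_eq_ev lin_ext_ev[OF assms])

text \<open>On \<open>D\<close> the map both preserves and reflects the order, so a chain in the
  image pulls back along the inverse to a chain in \<open>D\<close>.\<close>

lemma index_chains_image:
  fixes f :: "'i::linorder \<Rightarrow> 'j::linorder"
  assumes f: "strict_mono_on D f"
  shows "index_chains n (f ` D) = map f ` index_chains n D"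
proof
  have less_iff: "f x < f y \<longleftrightarrow> x < y" if "x \<in> D" "y \<in> D" for x y
    using that
    by (cases x y rule: linorder_cases) (auto dest: strict_mono_onD[OF f])
  have sorted_iff: "sorted_wrt (<) (map f is) \<longleftrightarrow> sorted_wrt (<) is" if "set is \<subseteq> D" for "is"
    using that by (induction "is") (auto simp: less_iff subset_iff)
  show "map f ` index_chains n D \<subseteq> index_chains n (f ` D)"
    by (auto simp: index_chains_def sorted_iff subset_iff)
  show "index_chains n (f ` D) \<subseteq> map f ` index_chains n D"
  proof
    fix js assume js: "js \<in> index_chains n (f ` D)"
    then have js_D: "set js \<subseteq> f ` D" by (simp add: index_chains_def)
    define "is" where "is = map (inv_into D f) js"
    have "set is \<subseteq> D"
      using js_D by (auto simp: is_def inv_into_into)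
    moreover have "js = map f is"
      using js_D by (auto simp: is_def map_idI f_inv_into_f subset_iff)
    ultimately show "js \<in> map f ` index_chains n D"
      using js sorted_iff[of "is"] by (auto simp: index_chains_def)
  qed
qed

lemma M_fin_image:
  assumes f: "strict_mono_on D f"
  shows "M_fin A I (f ` D) = M_fin (A \<circ> f) I D"
proof -
  have "inj_on f D"
    using f by (simp add: strict_mono_on_imp_inj_on)
  then have inj: "inj_on (map f) (index_chains (length I) D)"
    by (intro inj_on_mapI) (erule inj_on_subset, auto simp: index_chains_def)
  show ?thesis
    unfolding M_fin_def index_chains_image[OF f] sum.reindex[OF inj]
    by (rule sum.cong) (auto simp: M_term_def vec_power_def map2_map_map zip_map1 case_prod_unfold comp_def)
qed

lemma M_fin_cong:
  assumes "\<And>j c. j \<in> D \<Longrightarrow> A j c = B j c"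
  shows "M_fin A I D = M_fin B I D"
  unfolding M_fin_def M_term_def
  by (intro sum.cong refl arg_cong[where f = prod_list] map_cong)
    (auto simp: index_chains_def vec_power_def assms subset_iff dest: set_zip_leftD)

subsection \<open>Product alphabets\<close>

text \<open>The letters of \<open>X2_alph\<close> over an arbitrary index type: iterating the
  coproduct leads to products in which one factor is itself indexed by pairs.\<close>

definition left_alph :: "'r \<Rightarrow> 'c \<Rightarrow> (('r \<times> 'c \<Rightarrow>\<^sub>0 nat) \<times> ('s \<times> 'c \<Rightarrow>\<^sub>0 nat) \<Rightarrow>\<^sub>0 'k::field)"
  where "left_alph r c = single (single (r, c) 1, 0) 1"

definition right_alph :: "'s \<Rightarrow> 'c \<Rightarrow> (('r \<times> 'c \<Rightarrow>\<^sub>0 nat) \<times> ('s \<times> 'c \<Rightarrow>\<^sub>0 nat) \<Rightarrow>\<^sub>0 'k::field)"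
  where "right_alph s c = single (0, single (s, c) 1) 1"

definition prod_alph ::
    "'r \<times> 's \<Rightarrow> 'c::semigroup_add \<Rightarrow> (('r \<times> 'c \<Rightarrow>\<^sub>0 nat) \<times> ('s \<times> 'c \<Rightarrow>\<^sub>0 nat) \<Rightarrow>\<^sub>0 'k::field)"
  where "prod_alph = C_product left_alph right_alph"

lemma X2_alph_eq: "X2_alph = left_alph"
  by (simp add: fun_eq_iff X2_alph_def left_alph_def)

lemma Y2_alph_eq: "Y2_alph = right_alph"
  by (simp add: fun_eq_iff Y2_alph_def right_alph_def)

lemma XY_alph_eq: "XY_alph = prod_alph"
  by (simp add: XY_alph_def prod_alph_def X2_alph_eq Y2_alph_eq)

text \<open>The pairs \<open>(\<mu>, \<nu>)\<close> occurring in the expansion of \<open>\<tau>\<close> evaluated at a product alphabet.\<close>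

inductive splits ::
    "(('r \<times> 's) \<times> 'c::semigroup_add \<Rightarrow>\<^sub>0 nat) \<Rightarrow> ('r \<times> 'c \<Rightarrow>\<^sub>0 nat) \<Rightarrow> ('s \<times> 'c \<Rightarrow>\<^sub>0 nat) \<Rightarrow> bool"
  where
    zero: "splits 0 0 0"
  | add: "splits \<tau> \<mu> \<nu> \<Longrightarrow> splits (\<tau> + single ((r, s), \<alpha> + \<beta>) 1) (\<mu> + single (r, \<alpha>) 1) (\<nu> + single (s, \<beta>) 1)"

lemma keys_prod_alph:
  "keys (prod_alph (r, s) \<gamma> :: _ \<Rightarrow>\<^sub>0 'k::field) \<subseteq> {(single (r, \<alpha>) 1, single (s, \<beta>) 1) |\<alpha> \<beta>. \<alpha> + \<beta> = \<gamma>}"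
proof -
  have "keys (prod_alph (r, s) \<gamma> :: _ \<Rightarrow>\<^sub>0 'k) \<subseteq>
      (\<Union>(\<alpha>, \<beta>)\<in>{(\<alpha>, \<beta>). \<alpha> + \<beta> = \<gamma>}. keys (left_alph r \<alpha> * right_alph s \<beta> :: _ \<Rightarrow>\<^sub>0 'k))"
    unfolding prod_alph_def C_product_def case_prod_conv
    by (rule order_trans[OF keys_sum]) (simp add: case_prod_unfold)
  also have "\<dots> \<subseteq> {(single (r, \<alpha>) 1, single (s, \<beta>) 1) |\<alpha> \<beta>. \<alpha> + \<beta> = \<gamma>}"
    by (auto simp: left_alph_def right_alph_def mult_single)
  finally show ?thesis .
qed

text \<open>A monomial of a product of polynomials combines one monomial from each factor, so
  expanding letter by letter builds the split. The converse is not claimed: contributions may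
  cancel, for example in positive characteristic.\<close>

lemma splits_of_lookup_ev:
  fixes \<tau> :: "('r \<times> 's) \<times> 'c::semigroup_add \<Rightarrow>\<^sub>0 nat"
  assumes "lookup (ev (prod_alph :: _ \<Rightarrow> _ \<Rightarrow> _ \<Rightarrow>\<^sub>0 'k::field) \<tau>) (\<mu>, \<nu>) \<noteq> 0"
  shows "splits \<tau> \<mu> \<nu>"
  using assms
proof (induction \<tau> arbitrary: \<mu> \<nu> rule: monomial_induct)
  case zero
  then have "(\<mu>, \<nu>) = 0"
    by (simp add: lookup_one when_def split: if_splits)
  then show ?case
    by (simp add: zero_prod_def splits.zero)
next
  case (add \<tau> x)
  obtain r s \<gamma> where x: "x = ((r, s), \<gamma>)"
    by (metis surj_pair)
  have "(\<mu>, \<nu>) \<in> keys (ev (prod_alph :: _ \<Rightarrow> _ \<Rightarrow> _ \<Rightarrow>\<^sub>0 'k) \<tau> * prod_alph (r, s) \<gamma>)"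
    using add.prems by (simp add: x ev_add in_keys_iff)
  then obtain w z where wz: "(\<mu>, \<nu>) = w + z" "w \<in> keys (ev (prod_alph :: _ \<Rightarrow> _ \<Rightarrow> _ \<Rightarrow>\<^sub>0 'k) \<tau>)"
      "z \<in> keys (prod_alph (r, s) \<gamma> :: _ \<Rightarrow>\<^sub>0 'k)"
    using keys_mult by blast
  obtain \<mu>' \<nu>' where w: "w = (\<mu>', \<nu>')"
    by (metis surj_pair)
  obtain \<alpha> \<beta> where z: "z = (single (r, \<alpha>) 1, single (s, \<beta>) 1)" "\<alpha> + \<beta> = \<gamma>"
    using subsetD[OF keys_prod_alph wz(3)] by auto
  have "splits \<tau> \<mu>' \<nu>'"
    using wz(2) add.IH by (simp add: w in_keys_iff)
  from splits.add[OF this, of r s \<alpha> \<beta>] show ?case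
    using wz(1) by (simp add: w z(1) x z(2)[symmetric])
qed

lemma splits_keys:
  assumes "splits \<tau> \<mu> \<nu>"
  shows "((r, s), \<gamma>) \<in> keys \<tau> \<Longrightarrow> \<exists>\<alpha> \<beta>. \<gamma> = \<alpha> + \<beta> \<and> (r, \<alpha>) \<in> keys \<mu> \<and> (s, \<beta>) \<in> keys \<nu>"
    and "(r, \<alpha>) \<in> keys \<mu> \<Longrightarrow> \<exists>s \<beta>. ((r, s), \<alpha> + \<beta>) \<in> keys \<tau>"
    and "(s, \<beta>) \<in> keys \<nu> \<Longrightarrow> \<exists>r \<alpha>. ((r, s), \<alpha> + \<beta>) \<in> keys \<tau>"
  using assms by (induction rule: splits.induct) (simp_all add: keys_add_nat, blast+)

text \<open>A product letter is bilinear, so each step adds one letter on either side.\<close>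

lemma splits_deg: "splits \<tau> \<mu> \<nu> \<Longrightarrow> deg \<mu> = deg \<tau> \<and> deg \<nu> = deg \<tau>"
  by (induction rule: splits.induct) (simp_all add: deg_add)

lemma rows_single_1 [simp]: "rows (single (j, c) (Suc 0)) = {j}"
  by (simp add: rows_def)

lemma splits_rows: "splits \<tau> \<mu> \<nu> \<Longrightarrow> rows \<mu> = fst ` rows \<tau> \<and> rows \<nu> = snd ` rows \<tau>"
  by (induction rule: splits.induct) (simp_all add: rows_add)

lemma splits_rows_subset: "splits \<tau> \<mu> \<nu> \<Longrightarrow> rows \<tau> \<subseteq> rows \<mu> \<times> rows \<nu>"
  by (drule splits_rows) (clarsimp simp: rev_image_eqI)

lemma splits_colors:
  assumes "splits \<tau> \<mu> \<nu>"
  shows "snd ` keys \<mu> \<subseteq> fst ` {(\<alpha>, \<beta>). \<alpha> + \<beta> \<in> snd ` keys \<tau>}"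
    and "snd ` keys \<nu> \<subseteq> snd ` {(\<alpha>, \<beta>). \<alpha> + \<beta> \<in> snd ` keys \<tau>}"
  using splits_keys(2,3)[OF assms] by (force simp: image_iff)+

text \<open>Each letter of \<open>\<tau>\<close> combines a letter of \<open>\<mu>\<close> with one
  of \<open>\<nu>\<close>, and \<open>\<tau>\<close> has the degree of \<open>\<mu>\<close>. This
  makes the sum in \<open>coprod\<close> finite.\<close>

lemma finite_lookup_ev_prod_alph:
  fixes \<mu> :: "'r \<times> 'c::semigroup_add \<Rightarrow>\<^sub>0 nat" and \<nu> :: "'s \<times> 'c \<Rightarrow>\<^sub>0 nat"
  shows "finite {\<tau>. lookup (ev (prod_alph :: _ \<Rightarrow> _ \<Rightarrow> _ \<Rightarrow>\<^sub>0 'k::field) \<tau>) (\<mu>, \<nu>) \<noteq> 0}"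
proof (rule finite_subset)
  let ?D = "(\<lambda>((r, \<alpha>), (s, \<beta>)). ((r, s), \<alpha> + \<beta>)) ` (keys \<mu> \<times> keys \<nu>)"
  show "finite {\<tau>. keys \<tau> \<subseteq> ?D \<and> (\<forall>x. lookup \<tau> x \<le> deg \<mu>)}"
    by (rule finite_bounded_monomials) simp
  show "{\<tau>. lookup (ev (prod_alph :: _ \<Rightarrow> _ \<Rightarrow> _ \<Rightarrow>\<^sub>0 'k) \<tau>) (\<mu>, \<nu>) \<noteq> 0} \<subseteq>
      {\<tau>. keys \<tau> \<subseteq> ?D \<and> (\<forall>x. lookup \<tau> x \<le> deg \<mu>)}"
  proof clarify
    fix \<tau> assume "lookup (ev (prod_alph :: _ \<Rightarrow> _ \<Rightarrow> _ \<Rightarrow>\<^sub>0 'k) \<tau>) (\<mu>, \<nu>) \<noteq> 0"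
    then have splits: "splits \<tau> \<mu> \<nu>" by (rule splits_of_lookup_ev)
    have "((r, s), \<gamma>) \<in> ?D" if key: "((r, s), \<gamma>) \<in> keys \<tau>" for r s \<gamma>
    proof -
      obtain \<alpha> \<beta> where "\<gamma> = \<alpha> + \<beta>" "(r, \<alpha>) \<in> keys \<mu>" "(s, \<beta>) \<in> keys \<nu>"
        using splits_keys(1)[OF splits key] by blast
      then show ?thesis
        by (intro image_eqI[of _ _ "((r, \<alpha>), (s, \<beta>))"]) simp_all
    qed
    then have "keys \<tau> \<subseteq> ?D" by (metis surj_pair subsetI)
    then show "keys \<tau> \<subseteq> ?D \<and> (\<forall>x. lookup \<tau> x \<le> deg \<mu>)"
      using splits_deg[of \<tau> \<mu> \<nu>] lookup_le_deg[of \<tau>] splits by simp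
  qed
qed

lemma splits_of_lookup_M_term:
  fixes js :: "('r \<times> 's) list" and I :: "('c::semigroup_add \<Rightarrow>\<^sub>0 nat) list"
  assumes "length js = length I" "I \<in> vector_compositions"
    and "lookup (M_term (prod_alph :: _ \<Rightarrow> _ \<Rightarrow> _ \<Rightarrow>\<^sub>0 'k::field) I js) (\<mu>, \<nu>) \<noteq> 0"
  shows "rows \<mu> = fst ` set js" "rows \<nu> = snd ` set js"
proof -
  have "splits (place I js) \<mu> \<nu>"
    using assms(3) by (simp add: M_term_eq_ev[OF assms(1)] splits_of_lookup_ev)
  moreover have "rows (place I js) = set js"
    using assms(1,2) by (simp add: rows_place vector_compositions_def)
  ultimately show "rows \<mu> = fst ` set js" "rows \<nu> = snd ` set js"
    using splits_rows by metis+
qed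

text \<open>The indices in a contributing chain project into the rows of \<open>\<mu>\<close> and
  \<open>\<nu>\<close>, so cutting down to the box loses nothing.\<close>

lemma M_prod_alph_eq_M_fin:
  fixes \<mu> :: "'r::linorder \<times> 'c::semigroup_add \<Rightarrow>\<^sub>0 nat" and \<nu> :: "'s::linorder \<times> 'c \<Rightarrow>\<^sub>0 nat"
  assumes "I \<in> vector_compositions" "finite R" "finite S" "rows \<mu> \<subseteq> R" "rows \<nu> \<subseteq> S"
  shows "M prod_alph I (\<mu>, \<nu>) = lookup (M_fin (prod_alph :: _ \<Rightarrow> _ \<Rightarrow> _ \<Rightarrow>\<^sub>0 'k::field) I (R \<times> S)) (\<mu>, \<nu>)"
proof (rule M_eq_M_fin)
  fix js assume "length js = length I" "lookup (M_term (prod_alph :: _ \<Rightarrow> _ \<Rightarrow> _ \<Rightarrow>\<^sub>0 'k) I js) (\<mu>, \<nu>) \<noteq> 0"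
  note rows = splits_of_lookup_M_term[OF this(1) assms(1) this(2)]
  show "set js \<subseteq> R \<times> S"
  proof
    fix x assume "x \<in> set js"
    then have "fst x \<in> rows \<mu>" "snd x \<in> rows \<nu>"
      unfolding rows by (simp_all only: imageI)
    then show "x \<in> R \<times> S"
      using assms(4,5) by (simp add: mem_Times_iff subset_iff)
  qed
qed (use assms(2,3) in simp)

text \<open>Confines the monomials of the truncation to the box, where relabelling is known to be
  injective.\<close>

lemma rows_keys_M_fin_prod_alph:
  fixes R :: "'r::linorder set" and S :: "'s::linorder set" and I :: "('c::semigroup_add \<Rightarrow>\<^sub>0 nat) list"
  assumes "I \<in> vector_compositions"
    and "(\<mu>, \<nu>) \<in> keys (M_fin (prod_alph :: _ \<Rightarrow> _ \<Rightarrow> _ \<Rightarrow>\<^sub>0 'k::field) I (R \<times> S))"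
  shows "rows \<mu> \<subseteq> R" "rows \<nu> \<subseteq> S"
proof -
  obtain js where "js \<in> index_chains (length I) (R \<times> S)"
      "(\<mu>, \<nu>) \<in> keys (M_term (prod_alph :: _ \<Rightarrow> _ \<Rightarrow> _ \<Rightarrow>\<^sub>0 'k) I js)"
    using subsetD[OF keys_sum assms(2)[unfolded M_fin_def]] by blast
  then have js: "length js = length I" "set js \<subseteq> R \<times> S"
      "lookup (M_term (prod_alph :: _ \<Rightarrow> _ \<Rightarrow> _ \<Rightarrow>\<^sub>0 'k) I js) (\<mu>, \<nu>) \<noteq> 0"
    by (auto simp: index_chains_def in_keys_iff)
  show "rows \<mu> \<subseteq> R" "rows \<nu> \<subseteq> S"
    unfolding splits_of_lookup_M_term[OF js(1) assms(1) js(3)] using js(2) by auto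
qed

subsection \<open>Invariance under relabelling\<close>

text \<open>A push-forward: exponents add up where \<open>f\<close> merges indices, which makes it
  additive for every \<open>f\<close>.\<close>

definition relabel :: "('i \<Rightarrow> 'j) \<Rightarrow> ('i \<times> 'c \<Rightarrow>\<^sub>0 nat) \<Rightarrow> ('j \<times> 'c \<Rightarrow>\<^sub>0 nat)"
  where "relabel f u = (\<Sum>x\<in>keys u. single (f (fst x), snd x) (lookup u x))"

lemma relabel_0 [simp]: "relabel f 0 = 0"
  by (simp add: relabel_def)

lemma relabel_single [simp]: "relabel f (single (j, c) n) = single (f j, c) n"
  by (simp add: relabel_def)

lemma relabel_add: "relabel f (u + v) = relabel f u + relabel f v"
  unfolding relabel_def by (rule setsum_keys_plus_distrib) (simp_all add: single_add)

lemma relabel_relabel: "relabel g (relabel f u) = relabel (g \<circ> f) u"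
  by (induction u rule: monomial_induct) (auto simp: relabel_add)

lemma relabel_eq_self:
  assumes "\<And>j. j \<in> rows u \<Longrightarrow> f j = j"
  shows "relabel f u = u"
proof -
  have "relabel f u = (\<Sum>x\<in>keys u. single x (lookup u x))"
    unfolding relabel_def by (rule sum.cong) (auto simp: assms rows_def)
  then show ?thesis by (simp add: sum_single_lookup)
qed

lemma relabel_inj_on:
  assumes "inj_on f D" "rows u \<subseteq> D" "rows v \<subseteq> D" "relabel f u = relabel f v"
  shows "u = v"
proof -
  have "relabel (inv_into D f) (relabel f w) = w" if "rows w \<subseteq> D" for w
    unfolding relabel_relabel
    using that by (intro relabel_eq_self) (auto simp: inv_into_f_f[OF assms(1)])
  then show ?thesis using assms(2-4) by metis
qed

lemma relabel_place: "relabel f (place I js) = place I (map f js)"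
proof -
  have row: "relabel f (row j i) = row (f j) i" for j i
  proof -
    have add: "relabel f (\<Sum>c\<in>C. u c) = (\<Sum>c\<in>C. relabel f (u c))" for u C
      by (induction C rule: infinite_finite_induct) (simp_all add: relabel_add)
    show ?thesis by (simp add: row_def add)
  qed
  show ?thesis
  proof (induction js arbitrary: I)
    case (Cons j js)
    then show ?case by (cases I) (simp_all add: relabel_add row)
  qed simp
qed

lemma relabel_pack: "relabel (nth (sorted_list_of_set (rows u))) (pack u) = u"
proof -
  have "map (nth (sorted_list_of_set (rows u))) [0..<card (rows u)] = sorted_list_of_set (rows u)"
    by (metis length_sorted_list_of_set map_nth)
  then show ?thesis
    by (simp add: pack_def relabel_place place_columns)
qed

text \<open>Quasi-symmetry in both factors. Strictly increasing relabellings on the two sides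
  combine to a strictly increasing map of lexicographically ordered pairs, so the truncated series
  over the packed box is carried to the one over the original box.\<close>

lemma M_prod_alph_pack:
  fixes \<mu> :: "'r::linorder \<times> 'c::semigroup_add \<Rightarrow>\<^sub>0 nat" and \<nu> :: "'s::linorder \<times> 'c \<Rightarrow>\<^sub>0 nat"
  assumes I: "I \<in> vector_compositions"
  shows "M prod_alph I (\<mu>, \<nu>) = (M prod_alph I (pack \<mu>, pack \<nu>) :: 'k::field)"
proof -
  \<comment> \<open>\<open>f\<close> and \<open>g\<close> enumerate the indices of
    \<open>\<mu>\<close> and \<open>\<nu>\<close> increasingly from 0, and so undo
    \<open>pack\<close>.\<close>
  define f where "f = nth (sorted_list_of_set (rows \<mu>))"
  define g where "g = nth (sorted_list_of_set (rows \<nu>))"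
  define D where "D = {..<card (rows \<mu>)}"
  define E where "E = {..<card (rows \<nu>)}"
  have mono_f: "strict_mono_on D f" and mono_g: "strict_mono_on E g"
    by (auto simp: strict_mono_on_def f_def g_def D_def E_def intro: sorted_wrt_nth_less)
  have nth_img: "nth xs ` {..<length xs} = set xs" for xs :: "'x list"
    by (auto simp: set_conv_nth)
  have img: "f ` D = rows \<mu>" "g ` E = rows \<nu>"
    using nth_img[of "sorted_list_of_set (rows \<mu>)"] nth_img[of "sorted_list_of_set (rows \<nu>)"]
    by (simp_all add: f_def g_def D_def E_def)
  have pack: "relabel f (pack \<mu>) = \<mu>" "relabel g (pack \<nu>) = \<nu>"
    by (simp_all add: f_def g_def relabel_pack)
  \<comment> \<open>The linear extension of \<open>h\<close> renames indices on both sides, hence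
    sends the product letter at \<open>(r, s)\<close> to the one at
    \<open>(f r, g s)\<close>.\<close>
  define h :: "'c mon \<times> 'c mon \<Rightarrow> (('r \<times> 'c \<Rightarrow>\<^sub>0 nat) \<times> ('s \<times> 'c \<Rightarrow>\<^sub>0 nat) \<Rightarrow>\<^sub>0 'k)"
    where "h = (\<lambda>(u, v). single (relabel f u, relabel g v) 1)"
  have h: "mult_hom h"
    by (auto simp: mult_hom_def h_def zero_prod_def mult_single relabel_add
        simp flip: single_one)
  have h_letters: "lin_ext h (left_alph r c) = left_alph (f r) c" "lin_ext h (right_alph s c) = right_alph (g s) c" for r s c
    by (simp_all add: left_alph_def right_alph_def lin_ext_single h_def)
  have h_prod: "lin_ext h (prod_alph x c) = (prod_alph \<circ> map_prod f g) x c" for x c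
    unfolding prod_alph_def lin_ext_C_product[OF h] h_letters by (cases x) (simp add: C_product_def)
  have mono: "strict_mono_on (D \<times> E) (map_prod f g)"
    using mono_f mono_g by (auto simp: strict_mono_on_def less_prod_def')
  define P where "P = M_fin (prod_alph :: _ \<Rightarrow> 'c \<Rightarrow> _ \<Rightarrow>\<^sub>0 'k) I (D \<times> E)"
  \<comment> \<open>Only the packed pair is sent to \<open>(\<mu>, \<nu>)\<close>, so its
    coefficient is not mixed with others.\<close>
  have unique: "w = (pack \<mu>, pack \<nu>)" if "w \<in> keys P" "lookup (h w) (\<mu>, \<nu>) \<noteq> 0" for w
  proof -
    obtain u v where w: "w = (u, v)" by fastforce
    have "rows u \<subseteq> D" "rows v \<subseteq> E"
      using rows_keys_M_fin_prod_alph[OF I] that(1) unfolding P_def w by blast+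
    moreover have "relabel f u = \<mu>" "relabel g v = \<nu>"
      using that(2) by (auto simp: w h_def lookup_single when_def split: if_splits)
    ultimately show ?thesis
      using relabel_inj_on[of f D u "pack \<mu>"] relabel_inj_on[of g E v "pack \<nu>"] pack
        mono_f mono_g
      by (simp add: w rows_pack D_def E_def strict_mono_on_imp_inj_on)
  qed
  have "M prod_alph I (\<mu>, \<nu>) = lookup (M_fin prod_alph I (map_prod f g ` (D \<times> E))) (\<mu>, \<nu>)"
    using M_prod_alph_eq_M_fin[OF I, of "rows \<mu>" "rows \<nu>" \<mu> \<nu>]
    by (simp add: img map_prod_surj_on[OF img])
  also have "\<dots> = lookup (lin_ext h P) (\<mu>, \<nu>)"
    by (simp add: M_fin_image[OF mono] P_def lin_ext_M_fin[OF h] h_prod comp_def)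
  also have "\<dots> = (\<Sum>w\<in>keys P. if w = (pack \<mu>, pack \<nu>) then lookup P w else 0)"
    unfolding lookup_lin_ext
  proof (rule sum.cong)
    fix w assume "w \<in> keys P"
    then show "lookup P w * lookup (h w) (\<mu>, \<nu>) = (if w = (pack \<mu>, pack \<nu>) then lookup P w else 0)"
      using unique[of w] by (cases "w = (pack \<mu>, pack \<nu>)") (auto simp: h_def pack)
  qed simp
  also have "\<dots> = lookup P (pack \<mu>, pack \<nu>)"
    by (simp add: in_keys_iff)
  also have "\<dots> = M prod_alph I (pack \<mu>, pack \<nu>)"
    unfolding P_def by (rule M_prod_alph_eq_M_fin[OF I, symmetric]) (simp_all add: rows_pack D_def E_def)
  finally show ?thesis .
qed

subsection \<open>The coproduct\<close>

text \<open>A formula for \<open>\<delta>\<close> that is linear on all series and makes no choice of an expansion in the basis.\<close>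

definition coprod :: "('c::semigroup_add mon \<Rightarrow> 'k::field) \<Rightarrow> ('c mon \<times> 'c mon \<Rightarrow> 'k)"
  where "coprod f = (\<lambda>w. \<Sum>\<tau> | lookup (ev XY_alph \<tau> :: _ \<Rightarrow>\<^sub>0 'k) w \<noteq> 0.
    lookup (ev XY_alph \<tau>) w * f (pack \<tau>))"

lemma coprod_add: "coprod (f + g) = coprod f + coprod g"
  by (simp add: coprod_def fun_eq_iff distrib_left sum.distrib)

lemma coprod_scale: "coprod (scale a f) = scale a (coprod f)"
  by (simp add: coprod_def scale_def fun_eq_iff sum_distrib_left mult.left_commute)

lemma coprod_sum: "coprod (\<Sum>x\<in>S. f x) = (\<Sum>x\<in>S. coprod (f x))"
proof (induction S rule: infinite_finite_induct)
  case (insert x S)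
  then show ?case by (simp only: sum.insert coprod_add simp_thms)
qed (simp_all add: coprod_def fun_eq_iff)

text \<open>\<open>pack\<close> preserves columns, so by \<open>M_X_alph\<close> the weights select
  the \<open>\<tau>\<close> with columns \<open>I\<close>, as in
  \<open>M_eq_sum_monomials\<close>.\<close>

lemma coprod_M:
  fixes I :: "('c::semigroup_add \<Rightarrow>\<^sub>0 nat) list"
  assumes "I \<in> vector_compositions"
  shows "coprod (M X_alph I) = (M XY_alph I :: _ \<Rightarrow> 'k::field)"
proof
  fix w :: "'c mon \<times> 'c mon"
  let ?N = "\<lambda>\<tau>. lookup (ev XY_alph \<tau> :: _ \<Rightarrow>\<^sub>0 'k) w"
  have fin: "finite {\<tau>. ?N \<tau> \<noteq> 0}"
    using finite_lookup_ev_prod_alph[of "fst w" "snd w"] by (simp add: XY_alph_eq)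
  have "coprod (M X_alph I) w = (\<Sum>\<tau> | ?N \<tau> \<noteq> 0. if columns \<tau> = I then ?N \<tau> else 0)"
    unfolding coprod_def by (rule sum.cong) (simp_all add: M_X_alph[OF assms])
  also have "\<dots> = (\<Sum>\<tau> | ?N \<tau> \<noteq> 0 \<and> columns \<tau> = I. ?N \<tau>)"
    by (subst sum.inter_filter[OF fin, symmetric]) simp
  also have "\<dots> = M XY_alph I w"
    unfolding M_eq_sum_monomials[OF assms] by (simp only: conj_commute)
  finally show "coprod (M X_alph I) w = (M XY_alph I w :: 'k)" .
qed

section \<open>Membership of the coproduct in the tensor square\<close>

lemma sum_fun_apply: "(\<Sum>x\<in>S. f x) v = (\<Sum>x\<in>S. f x v)"
  by (induction S rule: infinite_finite_induct) simp_all

text \<open>Every color on either side comes from a decomposition, collected in \<open>G\<close>, of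
  one of the finitely many colors in \<open>I\<close>, and both degrees equal that of
  \<open>I\<close>. Finiteness of decompositions makes \<open>G\<close> finite.\<close>

lemma finite_columns_M_XY_alph:
  fixes I :: "('c::semigroup_add \<Rightarrow>\<^sub>0 nat) list"
  assumes fin: "\<And>\<gamma> :: 'c. finite {(\<alpha>, \<beta>). \<alpha> + \<beta> = \<gamma>}"
    and I: "I \<in> vector_compositions"
  shows "finite ((\<lambda>(u, v). (columns u, columns v)) ` {w. (M XY_alph I w :: 'k::field) \<noteq> 0})"
proof (rule finite_subset)
  define G where "G = {(\<alpha>, \<beta>). \<alpha> + \<beta> \<in> (\<Union>i\<in>set I. keys i)}"
  define n where "n = sum_list (map deg I)"
  have "G = (\<Union>\<gamma>\<in>\<Union>i\<in>set I. keys i. {(\<alpha>, \<beta>). \<alpha> + \<beta> = \<gamma>})"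
    by (auto simp: G_def)
  then have "finite G"
    by (simp add: fin)
  then show "finite ((columns ` {u :: 'c mon. snd ` keys u \<subseteq> fst ` G \<and> deg u \<le> n}) \<times>
      (columns ` {v :: 'c mon. snd ` keys v \<subseteq> snd ` G \<and> deg v \<le> n}))"
    by (intro finite_cartesian_product finite_columns_bounded finite_imageI)
  have support: "snd ` keys u \<subseteq> fst ` G \<and> deg u \<le> n \<and> snd ` keys v \<subseteq> snd ` G \<and> deg v \<le> n"
    if "(M XY_alph I (u, v) :: 'k) \<noteq> 0" for u v
  proof -
    have "{\<tau>. columns \<tau> = I \<and> lookup (ev XY_alph \<tau> :: _ \<Rightarrow>\<^sub>0 'k) (u, v) \<noteq> 0} \<noteq> {}"
      using that unfolding M_eq_sum_monomials[OF I] by (metis (no_types, lifting) sum.empty)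
    then obtain \<tau> where "columns \<tau> = I" and "lookup (ev XY_alph \<tau> :: _ \<Rightarrow>\<^sub>0 'k) (u, v) \<noteq> 0"
      by blast
    then have splits: "splits \<tau> u v" and I_eq: "I = columns \<tau>"
      by (auto simp: XY_alph_eq splits_of_lookup_ev)
    have G_eq: "G = {(\<alpha>, \<beta>). \<alpha> + \<beta> \<in> snd ` keys \<tau>}" and n_eq: "n = deg \<tau>"
      unfolding G_def n_def I_eq deg_columns keys_columns by (rule refl)+
    show ?thesis
      unfolding G_eq n_eq using splits_deg[OF splits] splits_colors[OF splits] by simp
  qed
  show "(\<lambda>(u, v). (columns u, columns v)) ` {w. (M XY_alph I w :: 'k) \<noteq> 0} \<subseteq>
      (columns ` {u :: 'c mon. snd ` keys u \<subseteq> fst ` G \<and> deg u \<le> n}) \<times>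
      (columns ` {v :: 'c mon. snd ` keys v \<subseteq> snd ` G \<and> deg v \<le> n})"
  proof (rule image_subsetI)
    fix w assume w: "w \<in> {w. (M XY_alph I w :: 'k) \<noteq> 0}"
    obtain u v where "w = (u, v)" by fastforce
    with w support[of u v] show "(case w of (u, v) \<Rightarrow> (columns u, columns v)) \<in>
        (columns ` {u :: 'c mon. snd ` keys u \<subseteq> fst ` G \<and> deg u \<le> n}) \<times>
        (columns ` {v :: 'c mon. snd ` keys v \<subseteq> snd ` G \<and> deg v \<le> n})"
      by (simp add: imageI)
  qed
qed

lemma M_in_QSym: "I \<in> vector_compositions \<Longrightarrow> M X_alph I \<in> QSym"
  unfolding QSym_def by (intro series.span_base imageI)

text \<open>By \<open>M_prod_alph_pack\<close> the coefficient depends only on the two column lists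
  and can be read off at packed monomials. The finitely many pairs in \<open>S\<close> then give an
  expansion into tensors of monomial functions.\<close>

lemma M_XY_alph_in_tensor_space:
  fixes I :: "('c::semigroup_add \<Rightarrow>\<^sub>0 nat) list"
  assumes fin: "\<And>\<gamma> :: 'c. finite {(\<alpha>, \<beta>). \<alpha> + \<beta> = \<gamma>}"
    and I: "I \<in> vector_compositions"
  shows "M XY_alph I \<in> tensor_space QSym (QSym :: ('c mon \<Rightarrow> 'k::field) set)"
proof -
  let ?c = "\<lambda>(u, v). (columns u, columns v)"
  let ?m = "M XY_alph I :: _ \<Rightarrow> 'k"
  let ?std = "\<lambda>J. place J [0..<length J] :: 'c mon"
  define S where "S = ?c ` {w. ?m w \<noteq> 0}"
  have S: "finite S"
    unfolding S_def by (rule finite_columns_M_XY_alph[OF fin I])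
  have S_vc: "J \<in> vector_compositions \<and> K \<in> vector_compositions" if "(J, K) \<in> S" for J K
    using that by (auto simp: S_def columns_in_vector_compositions)
  have std: "?std (columns u) = pack u" for u :: "'c mon"
    by (simp add: pack_def)
  have "?m = (\<Sum>(J, K)\<in>S. scale (?m (?std J, ?std K)) (tens (M X_alph J) (M X_alph K)))"
  proof
    fix w :: "'c mon \<times> 'c mon"
    obtain u v where w: "w = (u, v)" by fastforce
    have pack: "?m (pack u, pack v) = ?m (u, v)"
      unfolding XY_alph_eq by (rule M_prod_alph_pack[OF I, symmetric])
    have "(\<Sum>(J, K)\<in>S. scale (?m (?std J, ?std K)) (tens (M X_alph J) (M X_alph K))) w =
        (\<Sum>p\<in>S. if p = ?c w then ?m w else 0)"
      unfolding sum_fun_apply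
    proof (rule sum.cong)
      fix p assume "p \<in> S"
      then obtain J K where p: "p = (J, K)" "J \<in> vector_compositions" "K \<in> vector_compositions"
        using S_vc by (metis surj_pair)
      show "(case p of (J, K) \<Rightarrow> scale (?m (?std J, ?std K)) (tens (M X_alph J) (M X_alph K))) w =
          (if p = ?c w then ?m w else 0)"
        by (auto simp: w p M_X_alph scale_def tens_def std pack simp del: length_columns)
    qed simp
    \<comment> \<open>If the column lists of \<open>w\<close> form a pair outside \<open>S\<close>,
      then \<open>?m w\<close> is 0 by the choice of \<open>S\<close>.\<close>
    also have "\<dots> = ?m w"
      using S by (auto simp: S_def)
    finally show "?m w = (\<Sum>(J, K)\<in>S. scale (?m (?std J, ?std K)) (tens (M X_alph J) (M X_alph K))) w" ..
  qed
  also have "\<dots> \<in> tensor_space QSym QSym"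
    unfolding tensor_space_def
  proof (rule series.span_sum, clarify)
    fix J K assume "(J, K) \<in> S"
    then have "tens (M X_alph J) (M X_alph K) \<in> {tens f g |f g. f \<in> QSym \<and> g \<in> (QSym :: ('c mon \<Rightarrow> 'k) set)}"
      using S_vc M_in_QSym by blast
    then show "scale (?m (?std J, ?std K)) (tens (M X_alph J) (M X_alph K)) \<in>
        series.span {tens f g |f g. f \<in> QSym \<and> g \<in> (QSym :: ('c mon \<Rightarrow> 'k) set)}"
      by (intro series.span_scale series.span_base)
  qed
  finally show ?thesis .
qed

section \<open>Existence and uniqueness of the value on the product alphabet\<close>

lemma QSym_expansion:
  assumes "F \<in> QSym"
  shows "\<exists>a :: ('c \<Rightarrow>\<^sub>0 nat) list \<Rightarrow>\<^sub>0 'k::field. keys a \<subseteq> vector_compositions \<and>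
    F = (\<Sum>I\<in>keys a. scale (lookup a I) (M X_alph I))"
proof -
  obtain t r where t: "finite t" "t \<subseteq> M X_alph ` (vector_compositions :: ('c \<Rightarrow>\<^sub>0 nat) list set)"
    and F: "F = (\<Sum>f\<in>t. scale (r f) f)"
    using assms unfolding QSym_def series.span_explicit by blast
  \<comment> \<open>The span attaches coefficients to series, \<open>is_value\<close> to
    compositions. Choosing one composition for each series in \<open>t\<close> transports
    them.\<close>
  obtain C :: "('c \<Rightarrow>\<^sub>0 nat) list set"
    where C: "C \<subseteq> vector_compositions" "inj_on (M X_alph :: _ \<Rightarrow> _ \<Rightarrow> 'k) C" "t = M X_alph ` C"
    using t(2)[unfolded subset_image_inj] by blast
  have fin_C: "finite C"
    using t(1) C(2,3) by (simp add: finite_image_iff)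
  define b where "b = (\<lambda>I. if I \<in> C then r (M X_alph I) else 0)"
  define a where "a = Abs_poly_mapping b"
  have "finite {I. b I \<noteq> 0}"
    by (rule finite_subset[OF _ fin_C]) (auto simp: b_def split: if_splits)
  then have a: "lookup a = b"
    by (simp add: a_def)
  have keys_a: "keys a \<subseteq> C"
    by (auto simp: in_keys_iff a b_def split: if_splits)
  have "F = (\<Sum>I\<in>C. scale (b I) (M X_alph I))"
    unfolding F C(3) sum.reindex[OF C(2)] by (rule sum.cong) (simp_all add: b_def)
  also have "\<dots> = (\<Sum>I\<in>keys a. scale (lookup a I) (M X_alph I))"
    unfolding a using fin_C keys_a
    by (intro sum.mono_neutral_right) (auto simp: in_keys_iff a)
  finally show ?thesis
    using keys_a C(1) by blast
qed

text \<open>\<open>coprod\<close> is linear and correct on each monomial function, so every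
  expansion of \<open>F\<close> yields the same value; this justifies the description in
  \<open>\<delta>\<close>.\<close>

lemma is_value_XY_alph_iff:
  fixes F :: "'c::semigroup_add mon \<Rightarrow> 'k::field"
  assumes "F \<in> QSym"
  shows "is_value XY_alph F G \<longleftrightarrow> G = coprod F"
proof -
  have eq: "(\<Sum>I\<in>keys a. scale (lookup a I) (M XY_alph I)) =
      coprod (\<Sum>I\<in>keys a. scale (lookup a I) (M X_alph I))"
    if "keys a \<subseteq> vector_compositions" for a :: "('c \<Rightarrow>\<^sub>0 nat) list \<Rightarrow>\<^sub>0 'k"
    unfolding coprod_sum coprod_scale using that by (intro sum.cong) (auto simp: coprod_M)
  show ?thesis
  proof
    assume "is_value XY_alph F G"
    then show "G = coprod F"
      unfolding is_value_def by (auto simp: eq)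
  next
    assume "G = coprod F"
    moreover obtain a :: "('c \<Rightarrow>\<^sub>0 nat) list \<Rightarrow>\<^sub>0 'k" where "keys a \<subseteq> vector_compositions"
        "F = (\<Sum>I\<in>keys a. scale (lookup a I) (M X_alph I))"
      using QSym_expansion[OF assms] by blast
    ultimately show "is_value XY_alph F G"
      unfolding is_value_def by (intro exI[of _ a]) (simp add: eq)
  qed
qed

lemma \<delta>_eq_coprod: "F \<in> QSym \<Longrightarrow> \<delta> F = coprod F"
  by (simp add: \<delta>_def is_value_XY_alph_iff)

lemma coprod_in_tensor_space:
  fixes F :: "'c::semigroup_add mon \<Rightarrow> 'k::field"
  assumes fin: "\<And>\<gamma> :: 'c. finite {(\<alpha>, \<beta>). \<alpha> + \<beta> = \<gamma>}"
    and "F \<in> QSym"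
  shows "coprod F \<in> tensor_space QSym QSym"
proof -
  obtain a :: "('c \<Rightarrow>\<^sub>0 nat) list \<Rightarrow>\<^sub>0 'k" where a: "keys a \<subseteq> vector_compositions"
      "F = (\<Sum>I\<in>keys a. scale (lookup a I) (M X_alph I))"
    using QSym_expansion[OF assms(2)] by blast
  have "scale (lookup a I) (coprod (M X_alph I)) \<in> tensor_space QSym QSym" if "I \<in> keys a" for I
  proof -
    have "I \<in> vector_compositions" using that a(1) by blast
    then show ?thesis
      using M_XY_alph_in_tensor_space[OF fin, of I, where 'k = 'k]
      unfolding tensor_space_def by (auto simp: coprod_M intro: series.span_scale)
  qed
  then show ?thesis
    unfolding a(2) coprod_sum coprod_scale tensor_space_def by (rule series.span_sum)
qed

subsection \<open>Coassociativity\<close>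

text \<open>Both sides sum over triples of colors with sum \<open>\<gamma>\<close>. The nested pairs
  record different partial sums, which the bijection recomputes.\<close>

lemma C_product_assoc:
  fixes A :: "'r \<Rightarrow> 'c::semigroup_add \<Rightarrow> 'a::comm_semiring_1"
  assumes fin: "\<And>\<gamma> :: 'c. finite {(\<alpha>, \<beta>). \<alpha> + \<beta> = \<gamma>}"
  shows "C_product (C_product A B) C ((r, s), t) \<gamma> = C_product A (C_product B C) (r, (s, t)) \<gamma>"
proof -
  let ?S = "\<lambda>\<gamma> :: 'c. {(\<alpha>, \<beta>). \<alpha> + \<beta> = \<gamma>}"
  have "C_product (C_product A B) C ((r, s), t) \<gamma> =
      (\<Sum>p\<in>?S \<gamma>. \<Sum>q\<in>?S (fst p). A r (fst q) * B s (snd q) * C t (snd p))"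
    by (simp add: C_product_def case_prod_unfold sum_distrib_right)
  also have "\<dots> = (\<Sum>(p, q)\<in>(SIGMA p:?S \<gamma>. ?S (fst p)). A r (fst q) * B s (snd q) * C t (snd p))"
    by (rule sum.Sigma) (simp_all add: fin)
  also have "\<dots> = (\<Sum>(p, q)\<in>(SIGMA p:?S \<gamma>. ?S (snd p)). A r (fst p) * (B s (fst q) * C t (snd q)))"
    by (rule sum.reindex_bij_witness[where
          i = "\<lambda>((x, b), (y, c)). ((x + y, c), (x, y))" and
          j = "\<lambda>((a, c), (x, y)). ((x, y + c), (y, c))"])
      (auto simp: add.assoc mult.assoc)
  also have "\<dots> = (\<Sum>p\<in>?S \<gamma>. \<Sum>q\<in>?S (snd p). A r (fst p) * (B s (fst q) * C t (snd q)))"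
    by (rule sum.Sigma[symmetric]) (simp_all add: fin)
  also have "\<dots> = C_product A (C_product B C) (r, (s, t)) \<gamma>"
    by (simp add: C_product_def case_prod_unfold sum_distrib_left)
  finally show ?thesis .
qed

section \<open>Iterated coproducts in three alphabets\<close>

lemma lin_ext_mult_right: "lin_ext h p * q = lin_ext (\<lambda>m. h m * q) p"
  by (simp add: lin_ext_def sum_distrib_right mult.assoc)

text \<open>For a substitution of monomials under which only \<open>w\<close> can reach
  \<open>z\<close>, the coefficient is carried over unchanged; \<open>Q\<close> records whether
  \<open>w\<close> does reach it.\<close>

lemma lookup_lin_ext_single:
  assumes "\<And>m. m \<in> keys p \<Longrightarrow> \<phi> m = z \<longleftrightarrow> m = w \<and> Q"
  shows "lookup (lin_ext (\<lambda>m. single (\<phi> m) 1) p) z = (if Q then lookup p w else 0)"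
proof -
  have "lookup (lin_ext (\<lambda>m. single (\<phi> m) 1) p) z = (\<Sum>m\<in>keys p. if m = w then (if Q then lookup p w else 0) else 0)"
    unfolding lookup_lin_ext
  proof (rule sum.cong)
    fix m assume "m \<in> keys p"
    then show "lookup p m * lookup (single (\<phi> m) 1) z = (if m = w then (if Q then lookup p w else 0) else 0)"
      using assms[of m] by (auto simp: lookup_single when_def)
  qed simp
  then show ?thesis by (simp add: in_keys_iff)
qed

text \<open>Both iterated products are formed in one ring with three commuting alphabets, where they
  can be compared.\<close>

definition X3 :: "nat \<Rightarrow> 'c \<Rightarrow> ('c mon \<times> 'c mon \<times> 'c mon \<Rightarrow>\<^sub>0 'k::field)"
  where "X3 r c = single (single (r, c) 1, 0, 0) 1"

definition Y3 :: "nat \<Rightarrow> 'c \<Rightarrow> ('c mon \<times> 'c mon \<times> 'c mon \<Rightarrow>\<^sub>0 'k::field)"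
  where "Y3 s c = single (0, single (s, c) 1, 0) 1"

definition Z3 :: "nat \<Rightarrow> 'c \<Rightarrow> ('c mon \<times> 'c mon \<times> 'c mon \<Rightarrow>\<^sub>0 'k::field)"
  where "Z3 t c = single (0, 0, single (t, c) 1) 1"

text \<open>\<open>coprod\<close> weights the monomials \<open>\<tau>\<close> in the pair-indexed
  letters of X x Y by coefficients at \<open>pack \<tau>\<close>. Quasi-symmetry allows
  \<open>\<tau>\<close> itself there, and the sum becomes the substitution of X x Y for a
  pair-indexed left alphabet.\<close>

lemma coprod_left:
  fixes I :: "('c::semigroup_add \<Rightarrow>\<^sub>0 nat) list"
  assumes I: "I \<in> vector_compositions"
  shows "coprod (\<lambda>x. M XY_alph I (x, w)) (u, v) =
    lookup (M_fin (C_product (C_product X3 Y3) Z3) I ((rows u \<times> rows v) \<times> rows w) :: _ \<Rightarrow>\<^sub>0 'k::field) (u, v, w)"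
proof -
  define \<iota> :: "'c mon \<times> 'c mon \<Rightarrow> 'c mon \<times> 'c mon \<times> 'c mon \<Rightarrow>\<^sub>0 'k"
    where "\<iota> = (\<lambda>m. single (fst m, snd m, 0) 1)"
  \<comment> \<open>\<open>h\<close> substitutes product letters for the pair-indexed letters on the
    left and keeps the right monomial as its Z part.\<close>
  define h :: "((nat \<times> nat) \<times> 'c \<Rightarrow>\<^sub>0 nat) \<times> 'c mon \<Rightarrow> 'c mon \<times> 'c mon \<times> 'c mon \<Rightarrow>\<^sub>0 'k"
    where "h = (\<lambda>(\<tau>, w). lin_ext \<iota> (ev prod_alph \<tau>) * single (0, 0, w) 1)"
  define N where "N = (\<lambda>\<tau>. lookup (ev (prod_alph :: nat \<times> nat \<Rightarrow> 'c \<Rightarrow> _ \<Rightarrow>\<^sub>0 'k) \<tau>) (u, v))"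
  define R where "R = rows u \<times> rows v"
  define P where "P = M_fin (prod_alph :: (nat \<times> nat) \<times> nat \<Rightarrow> 'c \<Rightarrow> _ \<Rightarrow>\<^sub>0 'k) I (R \<times> rows w)"
  have \<iota>: "mult_hom \<iota>"
    by (simp add: mult_hom_def \<iota>_def mult_single flip: zero_prod_def)
  have one: "single (0, 0, 0) 1 = (1 :: 'c mon \<times> 'c mon \<times> 'c mon \<Rightarrow>\<^sub>0 'k)"
    by (simp flip: zero_prod_def)
  have lin_1: "lin_ext \<iota> 1 = 1"
    using lin_ext_single[of \<iota> 0 1] by (simp add: \<iota>_def one)
  have h_0: "h (\<tau>, 0) = lin_ext \<iota> (ev prod_alph \<tau>)" for \<tau>
    by (simp add: h_def one)
  have h: "mult_hom h"
    unfolding mult_hom_def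
  proof (intro conjI allI)
    show "h 0 = 1"
      by (simp add: zero_prod_def h_0 lin_1)
    fix a b :: "((nat \<times> nat) \<times> 'c \<Rightarrow>\<^sub>0 nat) \<times> 'c mon"
    have "single (0, 0, snd a + snd b) 1 =
        single (0, 0, snd a) 1 * (single (0, 0, snd b) 1 :: 'c mon \<times> 'c mon \<times> 'c mon \<Rightarrow>\<^sub>0 'k)"
      by (simp add: mult_single)
    then show "h (a + b) = h a * h b"
      by (simp add: h_def case_prod_unfold ev_add lin_ext_mult[OF \<iota>] ac_simps)
  qed
  have lookup_h: "lookup (h m) (u, v, w) = (if snd m = w then N (fst m) else 0)" for m
  proof -
    have "h m = lin_ext (\<lambda>n. single (fst n, snd n, snd m) 1) (ev prod_alph (fst m))"
      by (simp add: h_def case_prod_unfold lin_ext_mult_right \<iota>_def mult_single)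
    then show ?thesis
      unfolding N_def by (simp only:) (rule lookup_lin_ext_single, auto)
  qed
  have h_prod: "lin_ext h (prod_alph x c) = C_product (C_product X3 Y3) Z3 x c" for x c
  proof -
    have "lin_ext \<iota> (left_alph r c) = X3 r c" "lin_ext \<iota> (right_alph s c) = Y3 s c" for r s c
      by (simp_all add: lin_ext_single left_alph_def right_alph_def \<iota>_def X3_def Y3_def)
    then have "lin_ext \<iota> (prod_alph y c) = C_product X3 Y3 y c" for y c
      unfolding prod_alph_def lin_ext_C_product[OF \<iota>] by simp
    then have "lin_ext h (left_alph y c) = C_product X3 Y3 y c" for y c
      by (cases y) (simp add: lin_ext_single left_alph_def h_0)
    moreover have "lin_ext h (right_alph t c) = Z3 t c" for t c
      by (simp add: lin_ext_single right_alph_def h_def lin_1 Z3_def)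
    ultimately show ?thesis
      unfolding prod_alph_def lin_ext_C_product[OF h] by simp
  qed
  \<comment> \<open>Packing is idempotent, so the coefficients at \<open>(\<tau>, w)\<close>, over
    pair indices, and at \<open>(pack \<tau>, w)\<close>, over \<open>nat\<close>, both equal the
    one at the packed pair.\<close>
  have P: "M prod_alph I (pack \<tau>, w) = lookup P (\<tau>, w)" if "N \<tau> \<noteq> 0" for \<tau>
  proof -
    have "rows \<tau> \<subseteq> R"
      unfolding R_def using that by (intro splits_rows_subset splits_of_lookup_ev) (simp add: N_def)
    then have "lookup P (\<tau>, w) = M prod_alph I (\<tau>, w)"
      unfolding P_def by (subst M_prod_alph_eq_M_fin[OF I]) (simp_all add: R_def)
    then show ?thesis
      by (simp add: M_prod_alph_pack[OF I, of \<tau> w] M_prod_alph_pack[OF I, of "pack \<tau>" w])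
  qed
  have N: "lookup (ev prod_alph \<tau>) (u, v) = N \<tau>" for \<tau>
    by (simp add: N_def)
  have fin: "finite {\<tau>. N \<tau> \<noteq> 0}"
    unfolding N_def by (rule finite_lookup_ev_prod_alph)
  have "coprod (\<lambda>x. M XY_alph I (x, w)) (u, v) = (\<Sum>\<tau> | N \<tau> \<noteq> 0. N \<tau> * lookup P (\<tau>, w))"
    unfolding coprod_def XY_alph_eq N
    by (rule sum.cong) (simp_all add: P)
  also have "\<dots> = (\<Sum>m\<in>(\<lambda>\<tau>. (\<tau>, w)) ` {\<tau>. N \<tau> \<noteq> 0}. lookup P m * lookup (h m) (u, v, w))"
    by (subst sum.reindex) (auto simp: inj_on_def lookup_h mult.commute)
  also have "\<dots> = (\<Sum>m\<in>keys P. lookup P m * lookup (h m) (u, v, w))"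
  \<comment> \<open>Outside the image the right part is not \<open>w\<close> or
    \<open>N \<tau>\<close> is 0, so \<open>h\<close> contributes nothing; inside it, monomials
    missing from \<open>P\<close> have coefficient 0.\<close>
  proof (rule sum.mono_neutral_cong)
    fix m assume "m \<in> keys P - (\<lambda>\<tau>. (\<tau>, w)) ` {\<tau>. N \<tau> \<noteq> 0}"
    then show "lookup P m * lookup (h m) (u, v, w) = 0"
      by (cases m) (auto simp: lookup_h)
  qed (auto simp: fin in_keys_iff)
  also have "\<dots> = lookup (lin_ext h P) (u, v, w)"
    by (rule lookup_lin_ext[symmetric])
  also have "lin_ext h P = M_fin (C_product (C_product X3 Y3) Z3) I ((rows u \<times> rows v) \<times> rows w)"
    unfolding P_def lin_ext_M_fin[OF h] h_prod R_def ..
  finally show ?thesis .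
qed

text \<open>Mirror image of \<open>coprod_left\<close>: Y x Z is substituted for a pair-indexed
  right alphabet.\<close>

lemma coprod_right:
  fixes I :: "('c::semigroup_add \<Rightarrow>\<^sub>0 nat) list"
  assumes I: "I \<in> vector_compositions"
  shows "coprod (\<lambda>x. M XY_alph I (u, x)) (v, w) =
    lookup (M_fin (C_product X3 (C_product Y3 Z3)) I (rows u \<times> (rows v \<times> rows w)) :: _ \<Rightarrow>\<^sub>0 'k::field) (u, v, w)"
proof -
  define \<iota> :: "'c mon \<times> 'c mon \<Rightarrow> 'c mon \<times> 'c mon \<times> 'c mon \<Rightarrow>\<^sub>0 'k"
    where "\<iota> = (\<lambda>m. single (0, m) 1)"
  define h :: "'c mon \<times> ((nat \<times> nat) \<times> 'c \<Rightarrow>\<^sub>0 nat) \<Rightarrow> 'c mon \<times> 'c mon \<times> 'c mon \<Rightarrow>\<^sub>0 'k"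
    where "h = (\<lambda>(u, \<tau>). lin_ext \<iota> (ev prod_alph \<tau>) * single (u, 0) 1)"
  define N where "N = (\<lambda>\<tau>. lookup (ev (prod_alph :: nat \<times> nat \<Rightarrow> 'c \<Rightarrow> _ \<Rightarrow>\<^sub>0 'k) \<tau>) (v, w))"
  define R where "R = rows v \<times> rows w"
  define P where "P = M_fin (prod_alph :: nat \<times> (nat \<times> nat) \<Rightarrow> 'c \<Rightarrow> _ \<Rightarrow>\<^sub>0 'k) I (rows u \<times> R)"
  have \<iota>: "mult_hom \<iota>"
    by (simp add: mult_hom_def \<iota>_def mult_single flip: zero_prod_def)
  have one: "single (0, 0) 1 = (1 :: 'c mon \<times> 'c mon \<times> 'c mon \<Rightarrow>\<^sub>0 'k)"
    by (simp flip: zero_prod_def)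
  have lin_1: "lin_ext \<iota> 1 = 1"
    using lin_ext_single[of \<iota> 0 1] by (simp add: \<iota>_def one)
  have h_0: "h (0, \<tau>) = lin_ext \<iota> (ev prod_alph \<tau>)" for \<tau>
    by (simp add: h_def one)
  have h: "mult_hom h"
    unfolding mult_hom_def
  proof (intro conjI allI)
    show "h 0 = 1"
      by (simp add: zero_prod_def h_0 lin_1)
    fix a b :: "'c mon \<times> ((nat \<times> nat) \<times> 'c \<Rightarrow>\<^sub>0 nat)"
    have "single (fst a + fst b, 0) 1 =
        single (fst a, 0) 1 * (single (fst b, 0) 1 :: 'c mon \<times> 'c mon \<times> 'c mon \<Rightarrow>\<^sub>0 'k)"
      by (simp add: mult_single)
    then show "h (a + b) = h a * h b"
      by (simp add: h_def case_prod_unfold ev_add lin_ext_mult[OF \<iota>] ac_simps)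
  qed
  have lookup_h: "lookup (h m) (u, v, w) = (if fst m = u then N (snd m) else 0)" for m
  proof -
    have "h m = lin_ext (\<lambda>n. single (fst m, n) 1) (ev prod_alph (snd m))"
      by (simp add: h_def case_prod_unfold lin_ext_mult_right \<iota>_def mult_single)
    then show ?thesis
      unfolding N_def by (simp only:) (rule lookup_lin_ext_single, auto)
  qed
  have h_prod: "lin_ext h (prod_alph x c) = C_product X3 (C_product Y3 Z3) x c" for x c
  proof -
    have "lin_ext \<iota> (left_alph r c) = Y3 r c" "lin_ext \<iota> (right_alph s c) = Z3 s c" for r s c
      by (simp_all add: lin_ext_single left_alph_def right_alph_def \<iota>_def Y3_def Z3_def)
    then have "lin_ext \<iota> (prod_alph y c) = C_product Y3 Z3 y c" for y c
      unfolding prod_alph_def lin_ext_C_product[OF \<iota>] by simp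
    then have "lin_ext h (right_alph y c) = C_product Y3 Z3 y c" for y c
      by (cases y) (simp add: lin_ext_single right_alph_def h_0)
    moreover have "lin_ext h (left_alph r c) = X3 r c" for r c
      by (simp add: lin_ext_single left_alph_def h_def lin_1 X3_def zero_prod_def mult_single)
    ultimately show ?thesis
      unfolding prod_alph_def lin_ext_C_product[OF h] by simp
  qed
  have P: "M prod_alph I (u, pack \<tau>) = lookup P (u, \<tau>)" if "N \<tau> \<noteq> 0" for \<tau>
  proof -
    have "rows \<tau> \<subseteq> R"
      unfolding R_def using that by (intro splits_rows_subset splits_of_lookup_ev) (simp add: N_def)
    then have "lookup P (u, \<tau>) = M prod_alph I (u, \<tau>)"
      unfolding P_def by (subst M_prod_alph_eq_M_fin[OF I]) (simp_all add: R_def)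
    then show ?thesis
      by (simp add: M_prod_alph_pack[OF I, of u \<tau>] M_prod_alph_pack[OF I, of u "pack \<tau>"])
  qed
  have N: "lookup (ev prod_alph \<tau>) (v, w) = N \<tau>" for \<tau>
    by (simp add: N_def)
  have fin: "finite {\<tau>. N \<tau> \<noteq> 0}"
    unfolding N_def by (rule finite_lookup_ev_prod_alph)
  have "coprod (\<lambda>x. M XY_alph I (u, x)) (v, w) = (\<Sum>\<tau> | N \<tau> \<noteq> 0. N \<tau> * lookup P (u, \<tau>))"
    unfolding coprod_def XY_alph_eq N
    by (rule sum.cong) (simp_all add: P)
  also have "\<dots> = (\<Sum>m\<in>Pair u ` {\<tau>. N \<tau> \<noteq> 0}. lookup P m * lookup (h m) (u, v, w))"
    by (subst sum.reindex) (auto simp: inj_on_def lookup_h mult.commute)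
  also have "\<dots> = (\<Sum>m\<in>keys P. lookup P m * lookup (h m) (u, v, w))"
  proof (rule sum.mono_neutral_cong)
    fix m assume "m \<in> keys P - Pair u ` {\<tau>. N \<tau> \<noteq> 0}"
    then show "lookup P m * lookup (h m) (u, v, w) = 0"
      by (cases m) (auto simp: lookup_h)
  qed (auto simp: fin in_keys_iff)
  also have "\<dots> = lookup (lin_ext h P) (u, v, w)"
    by (rule lookup_lin_ext[symmetric])
  also have "lin_ext h P = M_fin (C_product X3 (C_product Y3 Z3)) I (rows u \<times> (rows v \<times> rows w))"
    unfolding P_def lin_ext_M_fin[OF h] h_prod R_def ..
  finally show ?thesis .
qed

text \<open>Both nested lexicographic orders compare first \<open>r\<close>, then \<open>s\<close>,
  then \<open>t\<close>, so rebracketing is increasing; the letters agree by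
  \<open>C_product_assoc\<close>.\<close>

lemma M_fin_C_product_assoc:
  fixes A :: "'r::linorder \<Rightarrow> 'c::semigroup_add \<Rightarrow> 'a::comm_semiring_1"
    and B :: "'s::linorder \<Rightarrow> 'c \<Rightarrow> 'a" and C :: "'t::linorder \<Rightarrow> 'c \<Rightarrow> 'a"
  assumes fin: "\<And>\<gamma> :: 'c. finite {(\<alpha>, \<beta>). \<alpha> + \<beta> = \<gamma>}"
  shows "M_fin (C_product (C_product A B) C) I ((R \<times> S) \<times> T) =
    M_fin (C_product A (C_product B C)) I (R \<times> (S \<times> T))"
proof -
  let ?f = "\<lambda>((r, s), t). (r, (s, t)) :: 'r \<times> 's \<times> 't"
  have img: "R \<times> (S \<times> T) = ?f ` ((R \<times> S) \<times> T)"
    by (force simp: image_iff)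
  have mono: "strict_mono_on ((R \<times> S) \<times> T) ?f"
    by (auto simp: strict_mono_on_def less_prod_def')
  show ?thesis
    unfolding img M_fin_image[OF mono] by (rule M_fin_cong) (auto simp: C_product_assoc[OF fin])
qed

text \<open>These represent \<open>\<delta> \<otimes> id\<close> and \<open>id \<otimes> \<delta>\<close>.\<close>

definition coprod_id :: "('c::semigroup_add mon \<times> 'n \<Rightarrow> 'k::field) \<Rightarrow> (('c mon \<times> 'c mon) \<times> 'n \<Rightarrow> 'k)"
  where "coprod_id G = (\<lambda>(m, n). coprod (\<lambda>x. G (x, n)) m)"

definition id_coprod :: "('n \<times> 'c::semigroup_add mon \<Rightarrow> 'k::field) \<Rightarrow> ('n \<times> 'c mon \<times> 'c mon \<Rightarrow> 'k)"
  where "id_coprod G = (\<lambda>(n, m). coprod (\<lambda>x. G (n, x)) m)"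

lemma coprod_pointwise:
  shows "coprod (\<lambda>u. f u + g u) w = coprod f w + coprod g w"
    and "coprod (\<lambda>u. a * f u) w = a * coprod f w"
    and "coprod (\<lambda>u. f u * a) w = coprod f w * a"
  by (simp_all add: coprod_def distrib_left sum.distrib sum_distrib_left sum_distrib_right ac_simps)

lemma linear_on_coprod_id: "linear_on V coprod_id"
  by (simp add: linear_on_def coprod_id_def scale_def fun_eq_iff coprod_pointwise)

lemma linear_on_id_coprod: "linear_on V id_coprod"
  by (simp add: linear_on_def id_coprod_def scale_def fun_eq_iff coprod_pointwise)

lemma coprod_id_tens: "coprod_id (tens f g) = tens (coprod f) g"
  by (simp add: coprod_id_def tens_def fun_eq_iff coprod_pointwise)

lemma id_coprod_tens: "id_coprod (tens f g) = tens f (coprod g)"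
  by (simp add: id_coprod_def tens_def fun_eq_iff coprod_pointwise)

text \<open>By linearity it suffices to treat monomial functions, where both sides are coefficients
  of the same truncation on the triple product alphabet.\<close>

lemma coprod_coassoc:
  fixes F :: "'c::semigroup_add mon \<Rightarrow> 'k::field"
  assumes fin: "\<And>\<gamma> :: 'c. finite {(\<alpha>, \<beta>). \<alpha> + \<beta> = \<gamma>}"
    and "F \<in> QSym"
  shows "tens_assoc (coprod_id (coprod F)) = id_coprod (coprod F)"
proof -
  obtain a :: "('c \<Rightarrow>\<^sub>0 nat) list \<Rightarrow>\<^sub>0 'k" where a: "keys a \<subseteq> vector_compositions"
      "F = (\<Sum>I\<in>keys a. scale (lookup a I) (M X_alph I))"
    using QSym_expansion[OF assms(2)] by blast
  have F: "coprod F = (\<lambda>m. \<Sum>I\<in>keys a. lookup a I * M XY_alph I m)"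
    unfolding a(2) coprod_sum coprod_scale
    unfolding fun_eq_iff sum_fun_apply scale_def
    using a(1) by (auto intro!: sum.cong simp: coprod_M subset_iff)
  have sum: "coprod (\<lambda>x. \<Sum>I\<in>T. g I x) w = (\<Sum>I\<in>T. coprod (g I) w)"
    for T :: "'i set" and g :: "'i \<Rightarrow> 'c mon \<Rightarrow> 'k" and w
  proof -
    have "(\<lambda>x. \<Sum>I\<in>T. g I x) = (\<Sum>I\<in>T. g I)"
      by (simp add: fun_eq_iff sum_fun_apply)
    then show ?thesis by (simp only: coprod_sum sum_fun_apply)
  qed
  have "coprod_id (coprod F) ((u, v), w) = id_coprod (coprod F) (u, v, w)" for u v w
  proof -
    have "coprod_id (coprod F) ((u, v), w) =
        (\<Sum>I\<in>keys a. lookup a I * coprod (\<lambda>x. M XY_alph I (x, w)) (u, v))"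
      by (simp add: coprod_id_def F sum coprod_pointwise)
    also have "\<dots> = (\<Sum>I\<in>keys a. lookup a I * coprod (\<lambda>x. M XY_alph I (u, x)) (v, w))"
    proof (rule sum.cong)
      fix I assume "I \<in> keys a"
      then have I: "I \<in> vector_compositions" using a(1) by blast
      show "lookup a I * coprod (\<lambda>x. M XY_alph I (x, w)) (u, v) =
          lookup a I * coprod (\<lambda>x. M XY_alph I (u, x)) (v, w)"
        unfolding coprod_left[OF I] coprod_right[OF I] M_fin_C_product_assoc[OF fin] ..
    qed simp
    also have "\<dots> = id_coprod (coprod F) (u, v, w)"
      by (simp add: id_coprod_def F sum coprod_pointwise)
    finally show ?thesis .
  qed
  then show ?thesis
    by (auto simp: tens_assoc_def fun_eq_iff)
qed

theorem proposition5p3: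
  assumes finite_decompositions:
    "\<And>\<gamma> :: 'c::semigroup_add. finite {(\<alpha>, \<beta>). \<alpha> + \<beta> = \<gamma>}"
  shows "(\<forall>F \<in> (QSym :: ('c mon \<Rightarrow> 'k::field) set). \<exists>!G. is_value XY_alph F G) \<and>
         coassociative_coproduct (QSym :: ('c mon \<Rightarrow> 'k) set) \<delta>"
proof
  let ?Q = "QSym :: ('c mon \<Rightarrow> 'k) set"
  show "\<forall>F \<in> ?Q. \<exists>!G. is_value XY_alph F G"
    by (simp add: is_value_XY_alph_iff)
  have closed: "F + G \<in> ?Q" "scale a F \<in> ?Q" if "F \<in> ?Q" "G \<in> ?Q" for F G a
    using that unfolding QSym_def by (auto intro: series.span_add series.span_scale)
  show "coassociative_coproduct ?Q \<delta>"
    unfolding coassociative_coproduct_def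
  proof (intro conjI exI ballI)
    show "linear_on ?Q \<delta>"
      unfolding linear_on_def by (simp add: closed \<delta>_eq_coprod coprod_add coprod_scale)
    show "\<delta> ` ?Q \<subseteq> tensor_space ?Q ?Q"
      using coprod_in_tensor_space[OF finite_decompositions] by (auto simp: \<delta>_eq_coprod)
    \<comment> \<open>The witnesses apply \<open>coprod\<close> to slices of a series; on tensors of
      elements of \<open>QSym\<close> this agrees with applying \<open>\<delta>\<close> to one
      factor.\<close>
    show "is_tensor_map ?Q ?Q \<delta> id coprod_id"
      by (simp add: is_tensor_map_def linear_on_coprod_id coprod_id_tens \<delta>_eq_coprod)
    show "is_tensor_map ?Q ?Q id \<delta> id_coprod"
      by (simp add: is_tensor_map_def linear_on_id_coprod id_coprod_tens \<delta>_eq_coprod)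
    show "tens_assoc (coprod_id (\<delta> F)) = id_coprod (\<delta> F)" if "F \<in> ?Q" for F
      using that by (simp add: \<delta>_eq_coprod coprod_coassoc[OF finite_decompositions])
  qed
qed

end
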